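(* Let $(E,\tau)$ be a locally solid vector lattice, where $\tau$ is a Fatou topology. Let $\tau^\delta$ be the extension of $\tau$ to a Fatou topology on the Dedekind completion $E^\delta$ of $E$. The following are equivalent: (1) $\tau$ is locally solidly submetrisable; (2) $\tau^\delta$ is locally solidly submetrisable; (3) $\tau^\delta$ is locally interval complete solidly submetrisable; (4) $C_\tau=E$; (5) $C_{\tau^\delta}=E^\delta$. When $\tau$ is an o-Lebesgue topology, (1)–(5) are also equivalent to: (6) $E$ has the countable sup property.
   Context: All vector lattices are real and Archimedean; linear topologies are Hausdorff. A locally solid topology on a vector lattice is a linear topology such that zero has a neighbourhood basis of solid sets. Order convergence: $x_\alpha\to x$ in order if there is a net $y_\beta\downarrow0$ such that for each $\beta_0$ there is $\alpha_0$ with $|x_\alpha-x|\leq y_{\beta_0}$ for $\alpha\geq\alpha_0$. A set is order closed if it contains the order limits of its nets. A Fatou topology is a locally solid topology in which zero has a neighbourhood basis of order closed solid sets; an o-Lebesgue topology is a locally solid topology in which order convergent nets converge topologically to the same limit. For a Fatou topology $\tau$ on $E$ there is a unique Fatou topology $\tau^\delta$ on $E^\delta$ extending $\tau$. A locally solid topology on a vector lattice $G$ is solidly submetrisable if it is finer than some metrisable locally solid topology on $G$; it is locally solidly submetrisable if its restriction to each principal band $B_x$ ($x\in G$) is solidly submetrisable; it is locally interval complete solidly submetrisable if for every $x\in G^+$ there is a metrisable locally solid topology $\widetilde\tau_x$ on $B_x$, coarser than the restriction to $B_x$, such that every $\widetilde\tau_x$-Cauchy sequence in $[0,x]$ converges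 in $\widetilde\tau_x$ to an element of $[0,x]$. A sequence $(V_n)$ of neighbourhoods of zero is normal if $V_{n+1}+V_{n+1}\subseteq V_n$; the carrier $C_\tau$ is the union of the disjoint complements $N^{\mathrm d}$ where $N=\bigcap_n V_n$ ranges over intersections of normal sequences of solid $\tau$-neighbourhoods of zero. $E$ has the countable sup property if every subset with a supremum in $E$ contains an at most countable subset with the same supremum. *)

theory Defs
  imports "HOL-Analysis.Analysis"
begin

definition vabs :: "'a::{ordered_real_vector,lattice} \<Rightarrow> 'a" where
  "vabs x = sup x (- x)"

definition archimedean_vl :: "'a::{ordered_real_vector,lattice} itself \<Rightarrow> bool" where
  "archimedean_vl _ \<longleftrightarrow>
     (\<forall>x y::'a. 0 \<le> x \<longrightarrow> (\<forall>n::nat. real n *\<^sub>R x \<le> y) \<longrightarrow> x = 0)"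

definition is_sup :: "'a::order set \<Rightarrow> 'a \<Rightarrow> bool" where
  "is_sup S s \<longleftrightarrow> (\<forall>x\<in>S. x \<le> s) \<and> (\<forall>z. (\<forall>x\<in>S. x \<le> z) \<longrightarrow> s \<le> z)"

definition is_inf :: "'a::order set \<Rightarrow> 'a \<Rightarrow> bool" where
  "is_inf S s \<longleftrightarrow> (\<forall>x\<in>S. s \<le> x) \<and> (\<forall>z. (\<forall>x\<in>S. z \<le> x) \<longrightarrow> z \<le> s)"

definition disj_compl :: "'a::{ordered_real_vector,lattice} set \<Rightarrow> 'a set" where
  "disj_compl S = {y. \<forall>z\<in>S. inf (vabs y) (vabs z) = 0}"

definition pband :: "'a::{ordered_real_vector,lattice} \<Rightarrow> 'a set" where
  "pband x = disj_compl (disj_compl {x})"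

definition solid_in :: "'a::{ordered_real_vector,lattice} set \<Rightarrow> 'a set \<Rightarrow> bool" where
  "solid_in G S \<longleftrightarrow> S \<subseteq> G \<and> (\<forall>x\<in>S. \<forall>y\<in>G. vabs y \<le> vabs x \<longrightarrow> y \<in> S)"

definition nhds0 :: "'a::{ordered_real_vector,lattice} topology \<Rightarrow> 'a set \<Rightarrow> bool" where
  "nhds0 T U \<longleftrightarrow> U \<subseteq> topspace T \<and> (\<exists>V. openin T V \<and> 0 \<in> V \<and> V \<subseteq> U)"

definition linear_topology_on :: "'a::{ordered_real_vector,lattice} set \<Rightarrow> 'a topology \<Rightarrow> bool" where
  "linear_topology_on G T \<longleftrightarrow> topspace T = G \<and> 0 \<in> G \<and> Hausdorff_space T \<and>
     continuous_map (prod_topology T T) T (\<lambda>(x,y). x + y) \<and>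
     continuous_map (prod_topology euclideanreal T) T (\<lambda>(c,x). c *\<^sub>R x)"

definition locally_solid_on :: "'a::{ordered_real_vector,lattice} set \<Rightarrow> 'a topology \<Rightarrow> bool" where
  "locally_solid_on G T \<longleftrightarrow> linear_topology_on G T \<and>
     (\<forall>U. nhds0 T U \<longrightarrow> (\<exists>V. nhds0 T V \<and> solid_in G V \<and> V \<subseteq> U))"

abbreviation locally_solid :: "'a::{ordered_real_vector,lattice} topology \<Rightarrow> bool" where
  "locally_solid T \<equiv> locally_solid_on UNIV T"

(* Order convergence.  A net (x_alpha) is represented by its filter of tails F
   (the image filter of the section filter); order convergence of a net only depends on F.
   "y_beta decreasing to 0" is represented by the range D of the net:
   a nonempty downward directed set with infimum 0. *)
definition order_conv :: "'a::{ordered_real_vector,lattice} filter \<Rightarrow> 'a \<Rightarrow> bool" where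
  "order_conv F l \<longleftrightarrow> (\<exists>D. D \<noteq> {} \<and> (\<forall>a\<in>D. \<forall>b\<in>D. \<exists>c\<in>D. c \<le> a \<and> c \<le> b) \<and>
      is_inf D 0 \<and> (\<forall>d\<in>D. eventually (\<lambda>y. vabs (y - l) \<le> d) F))"

definition order_closed :: "'a::{ordered_real_vector,lattice} set \<Rightarrow> bool" where
  "order_closed A \<longleftrightarrow> (\<forall>F l. F \<noteq> bot \<longrightarrow> eventually (\<lambda>y. y \<in> A) F \<longrightarrow> order_conv F l \<longrightarrow> l \<in> A)"

definition fatou :: "'a::{ordered_real_vector,lattice} topology \<Rightarrow> bool" where
  "fatou T \<longleftrightarrow> locally_solid T \<and>
     (\<forall>U. nhds0 T U \<longrightarrow> (\<exists>V. nhds0 T V \<and> solid_in UNIV V \<and> order_closed V \<and> V \<subseteq> U))"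

definition o_lebesgue :: "'a::{ordered_real_vector,lattice} topology \<Rightarrow> bool" where
  "o_lebesgue T \<longleftrightarrow> locally_solid T \<and>
     (\<forall>F l. F \<noteq> bot \<longrightarrow> order_conv F l \<longrightarrow> limitin T id l F)"

definition finer_than :: "'a topology \<Rightarrow> 'a topology \<Rightarrow> bool" where
  "finer_than T T' \<longleftrightarrow> topspace T = topspace T' \<and> (\<forall>U. openin T' U \<longrightarrow> openin T U)"

definition solidly_submetrisable :: "'a::{ordered_real_vector,lattice} set \<Rightarrow> 'a topology \<Rightarrow> bool" where
  "solidly_submetrisable G T \<longleftrightarrow> locally_solid_on G T \<and>
     (\<exists>T'. locally_solid_on G T' \<and> metrizable_space T' \<and> finer_than T T')"

definition locally_solidly_submetrisable :: "'a::{ordered_real_vector,lattice} topology \<Rightarrow> bool" where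
  "locally_solidly_submetrisable T \<longleftrightarrow>
     (\<forall>x. solidly_submetrisable (pband x) (subtopology T (pband x)))"

definition tvs_cauchy :: "'a::{ordered_real_vector,lattice} topology \<Rightarrow> (nat \<Rightarrow> 'a) \<Rightarrow> bool" where
  "tvs_cauchy T s \<longleftrightarrow> (\<forall>U. nhds0 T U \<longrightarrow> (\<exists>N. \<forall>m\<ge>N. \<forall>n\<ge>N. s m - s n \<in> U))"

definition loc_interval_complete_ssm :: "'a::{ordered_real_vector,lattice} topology \<Rightarrow> bool" where
  "loc_interval_complete_ssm T \<longleftrightarrow>
     (\<forall>x. 0 \<le> x \<longrightarrow> (\<exists>T'. locally_solid_on (pband x) T' \<and> metrizable_space T' \<and>
        finer_than (subtopology T (pband x)) T' \<and>
        (\<forall>s. (\<forall>n. s n \<in> {0..x}) \<longrightarrow> tvs_cauchy T' s \<longrightarrow>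
             (\<exists>l\<in>{0..x}. limitin T' s l sequentially))))"

definition normal_seq :: "'a::{ordered_real_vector,lattice} topology \<Rightarrow> (nat \<Rightarrow> 'a set) \<Rightarrow> bool" where
  "normal_seq T V \<longleftrightarrow> (\<forall>n. nhds0 T (V n) \<and> solid_in UNIV (V n) \<and>
      {a + b | a b. a \<in> V (Suc n) \<and> b \<in> V (Suc n)} \<subseteq> V n)"

definition carrier_top :: "'a::{ordered_real_vector,lattice} topology \<Rightarrow> 'a set" where
  "carrier_top T = \<Union> {disj_compl (\<Inter>n. V n) | V. normal_seq T V}"

definition countable_sup_property :: "'a::{ordered_real_vector,lattice} itself \<Rightarrow> bool" where
  "countable_sup_property _ \<longleftrightarrow>
     (\<forall>(S::'a set) s. is_sup S s \<longrightarrow> (\<exists>S'\<subseteq>S. countable S' \<and> is_sup S' s))"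

definition dedekind_completion ::
  "('a::{ordered_real_vector,lattice} \<Rightarrow> 'b::{ordered_real_vector,conditionally_complete_lattice}) \<Rightarrow> bool" where
  "dedekind_completion j \<longleftrightarrow> inj j \<and> linear j \<and>
     (\<forall>x y. j (sup x y) = sup (j x) (j y)) \<and> (\<forall>x y. j (inf x y) = inf (j x) (j y)) \<and>
     (\<forall>f. is_sup {j e | e. j e \<le> f} f \<and> is_inf {j e | e. f \<le> j e} f)"

end

theory Submission
  imports Defs
begin

text \<open>
  A normal sequence \<open>V\<close> with intersection \<open>N\<close> induces a metrisable locally solid topology on every ideal
  that meets \<open>N\<close> trivially, and a metrisable topology on the band of \<open>x\<close> yields, by refining its balls,
  a normal sequence with \<open>x\<close> disjoint from \<open>N\<close>. So local solid submetrisability of any locally solid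
  topology means that the carrier is everything. Normal sequences pull back along the embedding
  into the Dedekind completion, and they are pushed forward using that the image is order dense
  and majorising. Interval completeness follows Nakano: if the \<open>V n\<close> are order closed, a rapidly
  Cauchy sequence in an order interval converges to its limit inferior.

  For the countable sup property: in a Fatou topology the carrier elements in \<open>[0, x]\<close> have
  supremum \<open>x\<close> by the Archimedean property, and countably many normal sequences can be diagonalised.
  Conversely, the finite suprema of a set with supremum \<open>s\<close> converge to \<open>s\<close> in an o-Lebesgue topology,
  so one of them can be chosen within each \<open>V n\<close>, where \<open>V\<close> separates the band of \<open>s - a\<close>.
\<close>

section \<open>Vector lattices\<close>

lemma vabs_upper: "x \<le> vabs x" "- x \<le> vabs x"
  by (simp_all add: vabs_def)

lemma vabs_le_iff: "vabs x \<le> y \<longleftrightarrow> x \<le> y \<and> - x \<le> y"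
  by (simp add: vabs_def)

lemma vabs_nonneg [simp]: "0 \<le> vabs x"
proof -
  have "x + - x \<le> vabs x + vabs x"
    by (intro add_mono vabs_upper)
  then have "(1/2) *\<^sub>R 0 \<le> (1/2) *\<^sub>R (2 *\<^sub>R vabs x)"
    by (intro scaleR_left_mono) (simp_all add: scaleR_2)
  then show ?thesis
    by simp
qed

lemma vabs_of_nonneg [simp]: "0 \<le> x \<Longrightarrow> vabs x = x"
  by (rule order.antisym) (auto simp: vabs_le_iff vabs_upper intro: order_trans[of _ 0])

lemma vabs_zero [simp]: "vabs 0 = 0"
  by simp

lemma vabs_vabs [simp]: "vabs (vabs x) = vabs x"
  by simp

lemma vabs_minus [simp]: "vabs (- x) = vabs x"
  by (simp add: vabs_def sup_commute)

lemma vabs_minus_commute: "vabs (x - y) = vabs (y - x)"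
  by (metis minus_diff_eq vabs_minus)

lemma vabs_eq_0 [simp]: "vabs x = 0 \<longleftrightarrow> x = 0"
  by (metis vabs_upper vabs_zero neg_le_0_iff_le order.antisym)

lemma vabs_triangle: "vabs (x + y) \<le> vabs x + vabs y"
proof -
  have "- (x + y) = - x + - y" by simp
  then show ?thesis
    unfolding vabs_le_iff by (metis add_mono vabs_upper)
qed

lemma vabs_scaleR_le: "vabs (c *\<^sub>R x) \<le> \<bar>c\<bar> *\<^sub>R vabs x"
proof (cases "0 \<le> c")
  case True
  have "- (c *\<^sub>R x) = c *\<^sub>R (- x)" by simp
  with True show ?thesis
    unfolding vabs_le_iff by (simp del: scaleR_minus_right add: scaleR_left_mono vabs_upper)
next
  case False
  have "- (c *\<^sub>R x) = (- c) *\<^sub>R x" "c *\<^sub>R x = (- c) *\<^sub>R (- x)" by simp_all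
  with False show ?thesis
    unfolding vabs_le_iff
    by (metis abs_of_neg linorder_not_le neg_0_le_iff_le less_imp_le scaleR_left_mono vabs_upper)
qed

lemma vabs_scaleR_le_vabs: "\<bar>c\<bar> \<le> 1 \<Longrightarrow> vabs (c *\<^sub>R x) \<le> vabs x"
  using order_trans[OF vabs_scaleR_le scaleR_right_mono[of "\<bar>c\<bar>" 1 "vabs x"]] by simp

text \<open>With \<open>t\<close> the left side, \<open>t - b\<close> lies below \<open>a\<close>
  and \<open>c\<close>, so \<open>t - inf a c\<close> lies below \<open>b\<close>, and also below
  \<open>c\<close>. This is what makes disjoint complements additive.\<close>

lemma inf_add_le:
  fixes a b c :: "'a::{ordered_real_vector,lattice}"
  assumes "0 \<le> a" "0 \<le> b" "0 \<le> c"
  shows "inf (a + b) c \<le> inf a c + inf b c"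
proof -
  let ?t = "inf (a + b) c"
  have "?t - b \<le> a" "?t - b \<le> c"
    using assms by (simp_all add: diff_le_eq le_infI1 le_infI2 add_increasing2)
  then have "?t - b \<le> inf a c" by (rule inf_greatest)
  then have "?t - inf a c \<le> b"
    by (simp only: diff_le_eq add.commute)
  moreover have "?t - inf a c \<le> c"
    using assms by (simp add: diff_le_eq le_infI2 add_increasing2)
  ultimately have "?t - inf a c \<le> inf b c" by (rule inf_greatest)
  then show ?thesis
    by (simp only: diff_le_eq add.commute)
qed

lemma archimedeanD:
  fixes x y :: "'a::{ordered_real_vector,lattice}"
  assumes "archimedean_vl TYPE('a)" "0 \<le> x" "\<And>n::nat. real n *\<^sub>R x \<le> y"
  shows "x = 0"
  using assms unfolding archimedean_vl_def by blast

text \<open>Induction on \<open>n\<close>: a multiple below \<open>z\<close> stays below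
  \<open>z - t\<close>, so the next multiple is below \<open>z\<close> too, and the Archimedean
  property applies. Both exhaustion arguments about the carrier end this way.\<close>

lemma archimedean_step:
  fixes t z :: "'a::{ordered_real_vector,lattice}"
  assumes arch: "archimedean_vl TYPE('a)" and t: "0 \<le> t" "t \<le> z"
    and step: "\<And>n::nat. real n *\<^sub>R t \<le> z \<Longrightarrow> real n *\<^sub>R t \<le> z - t"
  shows "t = 0"
proof (rule archimedeanD[OF arch t(1)])
  show "real n *\<^sub>R t \<le> z" for n
  proof (induction n)
    case 0
    then show ?case using t order_trans by simp
  next
    case (Suc n)
    then show ?case
      using step[OF Suc] by (simp add: scaleR_left_distrib le_diff_eq add.commute)
  qed
qed

section \<open>Disjoint complements and bands\<close>

lemma disj_mono:
  fixes x y :: "'a::{ordered_real_vector,lattice}"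
  assumes "inf (vabs x) (vabs y) = 0" "vabs x' \<le> vabs x"
  shows "inf (vabs x') (vabs y) = 0"
proof (rule order.antisym)
  show "inf (vabs x') (vabs y) \<le> 0"
    using inf_mono[OF assms(2) order_refl, of "vabs y"] assms(1) by simp
qed simp

text \<open>These are the order ideals. Bands and intersections of normal sequences are both of this
  kind, so one notion serves the domains and the kernels of the pseudonorms below.\<close>

definition solid_subspace :: "'a::{ordered_real_vector,lattice} set \<Rightarrow> bool" where
  "solid_subspace G \<longleftrightarrow> 0 \<in> G \<and> (\<forall>x\<in>G. \<forall>y\<in>G. x + y \<in> G) \<and> (\<forall>c. \<forall>x\<in>G. c *\<^sub>R x \<in> G) \<and>
     (\<forall>x\<in>G. \<forall>y. vabs y \<le> vabs x \<longrightarrow> y \<in> G)"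

lemma solid_subspaceD:
  assumes "solid_subspace G"
  shows "0 \<in> G" "x \<in> G \<Longrightarrow> y \<in> G \<Longrightarrow> x + y \<in> G" "x \<in> G \<Longrightarrow> c *\<^sub>R x \<in> G"
    "x \<in> G \<Longrightarrow> vabs y \<le> vabs x \<Longrightarrow> y \<in> G" "x \<in> G \<Longrightarrow> - x \<in> G" "x \<in> G \<Longrightarrow> y \<in> G \<Longrightarrow> x - y \<in> G"
proof -
  show neg: "x \<in> G \<Longrightarrow> - x \<in> G" for x
    using assms unfolding solid_subspace_def by (metis order_refl vabs_minus)
  show "x \<in> G \<Longrightarrow> y \<in> G \<Longrightarrow> x - y \<in> G"
    using assms neg[of y] unfolding solid_subspace_def by (metis diff_conv_add_uminus)
qed (use assms in \<open>auto simp: solid_subspace_def\<close>)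

lemma disj_compl_iff: "y \<in> disj_compl S \<longleftrightarrow> (\<forall>z\<in>S. inf (vabs y) (vabs z) = 0)"
  by (simp add: disj_compl_def)

lemma solid_subspace_disj_compl: "solid_subspace (disj_compl S)"
  unfolding solid_subspace_def
proof (intro conjI ballI allI impI)
  show add: "x + y \<in> disj_compl S" if "x \<in> disj_compl S" "y \<in> disj_compl S" for x y
    unfolding disj_compl_iff
  proof
    fix z assume "z \<in> S"
    with that have 0: "inf (vabs x) (vabs z) = 0" "inf (vabs y) (vabs z) = 0"
      by (auto simp: disj_compl_iff)
    have "inf (vabs (x + y)) (vabs z) \<le> inf (vabs x + vabs y) (vabs z)"
      by (intro inf_mono vabs_triangle order_refl)
    also have "\<dots> \<le> 0"
      using inf_add_le[of "vabs x" "vabs y" "vabs z"] 0 by simp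
    finally show "inf (vabs (x + y)) (vabs z) = 0"
      by (simp add: order.antisym)
  qed
  show solid: "y \<in> disj_compl S" if "x \<in> disj_compl S" "vabs y \<le> vabs x" for x y
    using that disj_mono unfolding disj_compl_iff by blast
  show zero: "0 \<in> disj_compl S"
    by (simp add: disj_compl_iff inf_absorb1)
  show "c *\<^sub>R x \<in> disj_compl S" if x: "x \<in> disj_compl S" for c x
  proof -
    \<comment> \<open>Integer multiples come from additivity; \<open>c *\<^sub>R x\<close> is then
      dominated by one of them.\<close>
    have n: "real n *\<^sub>R x \<in> disj_compl S" for n
      using x zero by (induction n) (simp_all add: scaleR_left_distrib add)
    obtain n where n_ge: "\<bar>c\<bar> \<le> real n" and "0 < n"
      using reals_Archimedean2[of "\<bar>c\<bar>"] by (metis abs_ge_zero le_less_trans less_imp_le of_nat_0_less_iff)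
    have "c *\<^sub>R x = (c / n) *\<^sub>R (real n *\<^sub>R x)"
      using \<open>0 < n\<close> by simp
    then show ?thesis
      using solid[OF n[of n], of "c *\<^sub>R x"] n_ge \<open>0 < n\<close> vabs_scaleR_le_vabs[of "c / n" "real n *\<^sub>R x"]
      by simp
  qed
qed

lemma disj_compl_antimono: "S \<subseteq> T \<Longrightarrow> disj_compl T \<subseteq> disj_compl S"
  unfolding disj_compl_def by blast

text \<open>If \<open>t\<close> is the part of \<open>x\<close> below \<open>vabs u\<close>, every
  \<open>y\<close> in \<open>S\<close> is disjoint from \<open>t\<close>, so \<open>x - t\<close> is
  still an upper bound of \<open>S\<close>. This forces \<open>t = 0\<close>.\<close>

lemma disj_compl_is_sup:
  assumes "S \<subseteq> disj_compl N" "is_sup S x" "\<And>y. y \<in> S \<Longrightarrow> 0 \<le> y" "0 \<le> x"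
  shows "x \<in> disj_compl N"
  unfolding disj_compl_iff
proof
  fix u assume u: "u \<in> N"
  let ?t = "inf x (vabs u)"
  have t: "0 \<le> ?t" using assms by simp
  have "y \<le> x - ?t" if y: "y \<in> S" for y
  proof -
    have "inf y (vabs u) = 0"
      using assms(1,3) y u by (force simp: disj_compl_iff)
    then have "inf y ?t = 0"
      using t assms(3)[OF y] inf_mono[of y y ?t "vabs u"] by (simp add: order.antisym)
    \<comment> \<open>Both \<open>y\<close> and \<open>?t\<close> are below \<open>x\<close>, so
      moving \<open>x - y\<close> or \<open>x - ?t\<close> across gives the two bounds.\<close>
    have "y + ?t - x \<le> inf y ?t"
    proof -
      have "y \<le> x" using assms(2) y by (simp add: is_sup_def)
      then show ?thesis by (simp add: diff_le_eq add_mono add.commute)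
    qed
    with \<open>inf y ?t = 0\<close> show ?thesis by (simp add: le_diff_eq)
  qed
  then have "x \<le> x - ?t"
    using assms(2) by (simp add: is_sup_def)
  then have "?t \<le> 0" by (simp add: le_diff_eq)
  with t have "?t = 0" by (rule order.antisym[rotated])
  with assms(4) show "inf (vabs x) (vabs u) = 0" by simp
qed

lemma pband_self: "x \<in> pband x"
  by (auto simp: pband_def disj_compl_iff inf_commute)

lemma pband_subset_disj_compl:
  assumes "x \<in> disj_compl N"
  shows "pband x \<subseteq> disj_compl N"
proof -
  have "N \<subseteq> disj_compl {x}"
    using assms by (auto simp: disj_compl_iff inf_commute)
  then show ?thesis
    unfolding pband_def by (rule disj_compl_antimono)
qed

lemma solid_subspace_pband: "solid_subspace (pband x)"
  by (simp add: pband_def solid_subspace_disj_compl)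

lemma pband_vabs: "pband (vabs x) = pband x"
  by (simp add: pband_def disj_compl_def)

lemma disj_compl_self_Int: "x \<in> N \<Longrightarrow> x \<in> disj_compl N \<Longrightarrow> x = 0"
  by (auto simp: disj_compl_iff)


section \<open>Riesz pseudonorms and normal sequences\<close>

text \<open>Homogeneity is not demanded: in its place the last clause asks that scalar multiples of
  a fixed vector tend to zero with the scalar.\<close>

definition riesz_pseudonorm :: "('a::{ordered_real_vector,lattice} \<Rightarrow> real) \<Rightarrow> bool" where
  "riesz_pseudonorm p \<longleftrightarrow> p 0 = 0 \<and> (\<forall>x y. p (x + y) \<le> p x + p y) \<and>
     (\<forall>x y. vabs x \<le> vabs y \<longrightarrow> p x \<le> p y) \<and>
     (\<forall>x e. 0 < e \<longrightarrow> (\<exists>\<delta>>0. \<forall>c. \<bar>c\<bar> < \<delta> \<longrightarrow> p (c *\<^sub>R x) < e))"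

lemma riesz_pseudonormD:
  assumes "riesz_pseudonorm p"
  shows "p 0 = 0" "p (x + y) \<le> p x + p y" "vabs x \<le> vabs y \<Longrightarrow> p x \<le> p y"
    "0 < e \<Longrightarrow> \<exists>\<delta>>0. \<forall>c. \<bar>c\<bar> < \<delta> \<longrightarrow> p (c *\<^sub>R x) < e"
    "0 \<le> p x" "p (- x) = p x" "p (x - y) = p (y - x)"
proof -
  have mono: "vabs x \<le> vabs y \<Longrightarrow> p x \<le> p y" for x y
    using assms by (simp add: riesz_pseudonorm_def)
  show "p 0 = 0" using assms by (simp add: riesz_pseudonorm_def)
  with mono[of 0 x] show "0 \<le> p x" by simp
  show minus: "p (- x) = p x" for x
    using mono[of x "- x"] mono[of "- x" x] by simp
  show "p (x - y) = p (y - x)"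
    using minus[of "x - y"] by simp
qed (use assms in \<open>simp_all add: riesz_pseudonorm_def\<close>)

text \<open>Subadditivity gives integer factors, and monotonicity passes to real ones. This is
  enough for joint continuity of scalar multiplication.\<close>

lemma riesz_pseudonorm_scaleR_nat:
  assumes "riesz_pseudonorm p" "\<bar>c\<bar> \<le> real n"
  shows "p (c *\<^sub>R x) \<le> real n * p x"
proof -
  note D = riesz_pseudonormD[OF assms(1)]
  have "p (real n *\<^sub>R x) \<le> real n * p x"
  proof (induction n)
    case (Suc n)
    have "p (real (Suc n) *\<^sub>R x) \<le> p (real n *\<^sub>R x) + p x"
      using D(2)[of "real n *\<^sub>R x" x] by (simp add: scaleR_left_distrib add.commute)
    with Suc show ?case by (simp add: algebra_simps)
  qed (simp add: D)
  moreover have "p (c *\<^sub>R x) \<le> p (real n *\<^sub>R x)"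
  proof (cases "n = 0")
    case False
    then have "c *\<^sub>R x = (c / n) *\<^sub>R (real n *\<^sub>R x)" by simp
    with False assms(2) show ?thesis
      using vabs_scaleR_le_vabs[of "c / n" "real n *\<^sub>R x"] by (intro D(3)) simp
  qed (use assms in simp)
  ultimately show ?thesis by simp
qed

section \<open>Splitting weighted lists\<close>

lemma sum_list_crossing:
  fixes w :: "'c \<Rightarrow> real"
  assumes "r \<le> sum_list (map w xs)" "0 < r"
  shows "\<exists>ys z zs. xs = ys @ z # zs \<and> sum_list (map w ys) < r \<and> r \<le> sum_list (map w ys) + w z"
  using assms(1)
proof (induction xs rule: rev_induct)
  case (snoc x xs)
  show ?case
  proof (cases "sum_list (map w xs) < r")
    case True
    with snoc.prems show ?thesis
      by (intro exI[of _ xs] exI[of _ x] exI[of _ "[]"]) simp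
  next
    case False
    with snoc.IH obtain ys z zs where "xs = ys @ z # zs" "sum_list (map w ys) < r"
      "r \<le> sum_list (map w ys) + w z" by force
    then show ?thesis
      by (intro exI[of _ ys] exI[of _ z] exI[of _ "zs @ [x]"]) simp
  qed
qed (use assms(2) in simp)

text \<open>The combinatorial core of the Birkhoff--Kakutani argument: cutting at the entry where
  the partial sums reach \<open>r\<close> leaves less than \<open>r\<close> before it and, since the
  total is below \<open>2 * r\<close>, less than \<open>r\<close> after it.\<close>

lemma sum_list_balanced_split:
  fixes w :: "'c \<Rightarrow> real"
  assumes "xs \<noteq> []" "sum_list (map w xs) < 2 * r" "0 < r" "\<And>x. 0 \<le> w x"
  shows "\<exists>ys z zs. xs = ys @ z # zs \<and> sum_list (map w ys) < r \<and> sum_list (map w zs) < r"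
proof (cases "r \<le> sum_list (map w xs)")
  case True
  from sum_list_crossing[of r w xs, OF True assms(3)] obtain ys z zs where
    "xs = ys @ z # zs" "sum_list (map w ys) < r" "r \<le> sum_list (map w ys) + w z" by blast
  with assms(2) show ?thesis
    by (intro exI[of _ ys] exI[of _ z] exI[of _ zs]) simp
next
  case False
  \<comment> \<open>The whole list already weighs less than \<open>r\<close>, so splitting off its
    last entry works.\<close>
  then have r: "sum_list (map w xs) < r" by simp
  have "sum_list (map w xs) = sum_list (map w (butlast xs)) + w (last xs)"
    using assms(1) by (cases xs rule: rev_cases) simp_all
  with r assms(1,3) assms(4)[of "last xs"] show ?thesis
    by (intro exI[of _ "butlast xs"] exI[of _ "last xs"] exI[of _ "[]"]) simp
qed

text \<open>The Birkhoff--Kakutani construction. A list of pairs \<open>(u, n)\<close> encodes a finite sum of positive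
  vectors \<open>u \<in> V n\<close>, each charged \<open>1 / 2 ^ n\<close>. Asking the sum to dominate \<open>vabs x\<close>, rather than to equal
  \<open>x\<close>, makes the resulting pseudonorm monotone without a Riesz decomposition; inserting \<open>1\<close> makes
  the infimum meaningful for all \<open>x\<close>.\<close>

definition chain_weight :: "('a \<times> nat) list \<Rightarrow> real" where
  "chain_weight c = (\<Sum>(u, n)\<leftarrow>c. 1 / 2 ^ n)"

definition chain_sum :: "('a::comm_monoid_add \<times> nat) list \<Rightarrow> 'a" where
  "chain_sum c = sum_list (map fst c)"

definition chain_in :: "(nat \<Rightarrow> 'a::{ordered_real_vector,lattice} set) \<Rightarrow> ('a \<times> nat) list \<Rightarrow> bool" where
  "chain_in V c \<longleftrightarrow> (\<forall>(u, n)\<in>set c. 0 \<le> u \<and> u \<in> V n)"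

definition chain_norm :: "(nat \<Rightarrow> 'a::{ordered_real_vector,lattice} set) \<Rightarrow> 'a \<Rightarrow> real" where
  "chain_norm V x = Inf (insert 1 {chain_weight c | c. chain_in V c \<and> vabs x \<le> chain_sum c})"

lemma chain_append:
  "chain_weight (c @ d) = chain_weight c + chain_weight d"
  "chain_sum (c @ d) = chain_sum c + chain_sum d"
  "chain_in V (c @ d) \<longleftrightarrow> chain_in V c \<and> chain_in V d"
  by (auto simp: chain_weight_def chain_sum_def chain_in_def)

lemma chain_weight_nonneg: "0 \<le> chain_weight c"
  by (auto simp: chain_weight_def intro!: sum_list_nonneg)

lemma chain_norm_le_1: "chain_norm V x \<le> 1"
  and chain_norm_le: "chain_in V c \<Longrightarrow> vabs x \<le> chain_sum c \<Longrightarrow> chain_norm V x \<le> chain_weight c"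
  and chain_norm_nonneg: "0 \<le> chain_norm V x"
  and chain_norm_lessD: "chain_norm V x < r \<Longrightarrow> r \<le> 1 \<Longrightarrow>
    \<exists>c. chain_in V c \<and> vabs x \<le> chain_sum c \<and> chain_weight c < r"
proof -
  let ?S = "insert 1 {chain_weight c | c. chain_in V c \<and> vabs x \<le> chain_sum c}"
  have bdd: "bdd_below ?S"
    by (rule bdd_belowI[of _ 0]) (auto simp: chain_weight_nonneg)
  show "chain_norm V x \<le> 1"
    unfolding chain_norm_def by (rule cInf_lower[OF _ bdd]) simp
  show "chain_in V c \<Longrightarrow> vabs x \<le> chain_sum c \<Longrightarrow> chain_norm V x \<le> chain_weight c"
    unfolding chain_norm_def by (rule cInf_lower[OF _ bdd]) blast
  show "0 \<le> chain_norm V x"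
    unfolding chain_norm_def by (rule cInf_greatest) (auto simp: chain_weight_nonneg)
  assume "chain_norm V x < r" "r \<le> 1"
  then obtain s where "s \<in> ?S" "s < r"
    unfolding chain_norm_def using cInf_lessD[of ?S r] by blast
  with \<open>r \<le> 1\<close> show "\<exists>c. chain_in V c \<and> vabs x \<le> chain_sum c \<and> chain_weight c < r"
    by auto
qed

lemma chain_norm_triangle: "chain_norm V (x + y) \<le> chain_norm V x + chain_norm V y"
proof (rule field_le_epsilon)
  fix e :: real assume "0 < e"
  show "chain_norm V (x + y) \<le> chain_norm V x + chain_norm V y + e"
  proof (cases "chain_norm V x + e/2 \<le> 1 \<and> chain_norm V y + e/2 \<le> 1")
    case True
    obtain c where c: "chain_in V c" "vabs x \<le> chain_sum c" "chain_weight c < chain_norm V x + e/2"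
      using chain_norm_lessD[of V x "chain_norm V x + e/2"] True \<open>0 < e\<close> by auto
    obtain d where d: "chain_in V d" "vabs y \<le> chain_sum d" "chain_weight d < chain_norm V y + e/2"
      using chain_norm_lessD[of V y "chain_norm V y + e/2"] True \<open>0 < e\<close> by auto
    have "vabs (x + y) \<le> chain_sum (c @ d)"
      unfolding chain_append by (rule order_trans[OF vabs_triangle add_mono[OF c(2) d(2)]])
    then have "chain_norm V (x + y) \<le> chain_weight (c @ d)"
      using c d by (intro chain_norm_le) (simp_all add: chain_append)
    with c d show ?thesis by (simp add: chain_append)
  next
    \<comment> \<open>No cheap chain need exist for one of the two vectors. The right side then
      exceeds \<open>1\<close>, which bounds \<open>chain_norm\<close> anyway.\<close>
    case False
    then show ?thesis
      using chain_norm_le_1[of V "x + y"] chain_norm_nonneg[of V x] chain_norm_nonneg[of V y] \<open>0 < e\<close>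
      by (auto simp: not_le)
  qed
qed

lemma chain_norm_mono:
  assumes "vabs x \<le> vabs y"
  shows "chain_norm V x \<le> chain_norm V y"
  unfolding chain_norm_def
proof (rule cInf_superset_mono)
  show "bdd_below (insert 1 {chain_weight c | c. chain_in V c \<and> vabs x \<le> chain_sum c})"
    by (rule bdd_belowI[of _ 0]) (auto simp: chain_weight_nonneg)
  show "insert 1 {chain_weight c | c. chain_in V c \<and> vabs y \<le> chain_sum c} \<subseteq>
    insert 1 {chain_weight c | c. chain_in V c \<and> vabs x \<le> chain_sum c}"
    using order_trans[OF assms] by blast
qed simp

text \<open>Induction on the length. A balanced split leaves two outer chains of weight below
  \<open>1 / 2 ^ Suc n\<close>. The middle entry is charged less than \<open>1 / 2 ^ n\<close>, so
  its index is at least \<open>Suc n\<close>. All three parts thus lie in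
  \<open>V (Suc n)\<close>.\<close>

lemma chain_sum_in:
  assumes solid: "\<And>n. solid_in UNIV (V n)" and zero: "\<And>n. 0 \<in> V n"
    and add3: "\<And>n a b c. a \<in> V (Suc n) \<Longrightarrow> b \<in> V (Suc n) \<Longrightarrow> c \<in> V (Suc n) \<Longrightarrow> a + b + c \<in> V n"
    and c: "chain_in V c" "chain_weight c < 1 / 2 ^ n"
  shows "chain_sum c \<in> V n"
  using c
proof (induction "length c" arbitrary: c n rule: less_induct)
  case less
  have anti: "V m \<subseteq> V k" if "k \<le> m" for k m
  proof (rule lift_Suc_antimono_le[OF _ that])
    show "V (Suc i) \<subseteq> V i" for i
      using add3[OF _ zero zero, of _ i] by auto
  qed
  show ?case
  proof (cases "c = []")
    case False
    let ?w = "\<lambda>z::'a \<times> nat. (1::real) / 2 ^ snd z"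
    have w: "chain_weight d = sum_list (map ?w d)" for d :: "('a \<times> nat) list"
      by (simp add: chain_weight_def case_prod_unfold)
    obtain c1 z c2 where split: "c = c1 @ z # c2"
      "chain_weight c1 < 1 / 2 ^ Suc n" "chain_weight c2 < 1 / 2 ^ Suc n"
      using sum_list_balanced_split[OF False, of ?w "1 / 2 ^ Suc n"] less.prems(2) unfolding w by auto
    have "chain_in V c1" "chain_in V c2" and z: "fst z \<in> V (snd z)"
      using less.prems(1) unfolding split(1) by (auto simp: chain_in_def)
    with split less.hyps have "chain_sum c1 \<in> V (Suc n)" "chain_sum c2 \<in> V (Suc n)"
      by auto
    moreover have "(1::real) / 2 ^ snd z < 1 / 2 ^ n"
      using less.prems(2) chain_weight_nonneg[of c1] chain_weight_nonneg[of c2]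
      unfolding split(1) w by simp
    then have "Suc n \<le> snd z"
      by (simp add: field_simps)
    with z anti have "fst z \<in> V (Suc n)" by blast
    ultimately have "chain_sum c1 + fst z + chain_sum c2 \<in> V n"
      by (intro add3)
    then show ?thesis
      by (simp add: split(1) chain_sum_def add.assoc)
  qed (simp add: chain_sum_def zero)
qed

text \<open>The pseudonorm is \<open>chain_norm V\<close>. One-entry chains give the upper bound on
  \<open>V n\<close>, \<open>chain_sum_in\<close> gives the converse inclusion, and absorption gives
  continuity in the scalar.\<close>

lemma riesz_pseudonorm_of_seq:
  assumes solid: "\<And>n. solid_in UNIV (V n)" and zero: "\<And>n. 0 \<in> V n"
    and add3: "\<And>n a b c. a \<in> V (Suc n) \<Longrightarrow> b \<in> V (Suc n) \<Longrightarrow> c \<in> V (Suc n) \<Longrightarrow> a + b + c \<in> V n"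
    and absorb: "\<And>n x. \<exists>\<delta>>0. \<forall>c. \<bar>c\<bar> < \<delta> \<longrightarrow> c *\<^sub>R x \<in> V n"
  shows "\<exists>p. riesz_pseudonorm p \<and> (\<forall>n x. p x < 1 / 2 ^ n \<longrightarrow> x \<in> V n) \<and>
    (\<forall>n x. x \<in> V n \<longrightarrow> p x \<le> 1 / 2 ^ n)"
proof (intro exI conjI allI impI)
  let ?p = "chain_norm V"
  have solidD: "x \<in> V n \<Longrightarrow> vabs y \<le> vabs x \<Longrightarrow> y \<in> V n" for x y n
    using solid[of n] unfolding solid_in_def by blast
  show le: "?p x \<le> 1 / 2 ^ n" if "x \<in> V n" for n x
  proof -
    have "vabs x \<in> V n" using solidD[OF that, of "vabs x"] by simp
    then show ?thesis
      using chain_norm_le[of V "[(vabs x, n)]" x]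
      by (simp add: chain_in_def chain_sum_def chain_weight_def)
  qed
  show "x \<in> V n" if p: "?p x < 1 / 2 ^ n" for n x
  proof -
    obtain c where c: "chain_in V c" "vabs x \<le> chain_sum c" "chain_weight c < 1 / 2 ^ n"
      using chain_norm_lessD[OF p] by auto
    have "chain_sum c \<in> V n"
      by (rule chain_sum_in[OF solid zero add3 c(1,3)])
    moreover have "vabs x \<le> vabs (chain_sum c)"
      using c(2) vabs_upper(1) order_trans by blast
    ultimately show ?thesis by (rule solidD)
  qed
  show "riesz_pseudonorm ?p"
    unfolding riesz_pseudonorm_def
  proof (intro conjI allI impI chain_norm_triangle chain_norm_mono)
    show "?p 0 = 0"
      using chain_norm_le[of V "[]" 0] chain_norm_nonneg[of V 0]
      by (simp add: chain_in_def chain_sum_def chain_weight_def)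
    fix x :: 'a and e :: real assume "0 < e"
    then obtain n where n: "(1/2) ^ n < e"
      using real_arch_pow_inv[of e "1/2"] by auto
    obtain \<delta> where "0 < \<delta>" "\<And>c. \<bar>c\<bar> < \<delta> \<Longrightarrow> c *\<^sub>R x \<in> V n"
      using absorb[of x n] by blast
    then show "\<exists>\<delta>>0. \<forall>c. \<bar>c\<bar> < \<delta> \<longrightarrow> ?p (c *\<^sub>R x) < e"
      using le n by (intro exI[of _ \<delta>]) (fastforce simp: power_divide)
  qed
qed


section \<open>Metrisable topologies defined by Riesz pseudonorms\<close>

text \<open>The metric is \<open>p (x - y)\<close> on \<open>G\<close>. Definiteness is asked on
  \<open>G\<close> only, since the pseudonorms used may vanish elsewhere. Open sets, neighbourhoods
  of zero and limits are described through \<open>p\<close>, so that the metric stays hidden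
  afterwards.\<close>

lemma pseudonorm_topology:
  fixes p :: "'a::{ordered_real_vector,lattice} \<Rightarrow> real"
  assumes p: "riesz_pseudonorm p" and G: "solid_subspace G"
    and definite: "\<And>x. x \<in> G \<Longrightarrow> p x = 0 \<Longrightarrow> x = 0"
  obtains T where "locally_solid_on G T" "metrizable_space T"
    "\<And>U. openin T U \<longleftrightarrow> U \<subseteq> G \<and> (\<forall>x\<in>U. \<exists>r>0. \<forall>y\<in>G. p (y - x) < r \<longrightarrow> y \<in> U)"
    "\<And>U. nhds0 T U \<longleftrightarrow> U \<subseteq> G \<and> (\<exists>r>0. {x\<in>G. p x < r} \<subseteq> U)"
    "\<And>s l. range s \<subseteq> G \<Longrightarrow> l \<in> G \<Longrightarrow> (\<lambda>n. p (s n - l)) \<longlonglongrightarrow> 0 \<Longrightarrow> limitin T s l sequentially"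
proof -
  note pD = riesz_pseudonormD[OF p]
  note GD = solid_subspaceD(1,2,3,5,6)[OF G]
  interpret M: Metric_space G "\<lambda>x y. p (x - y)"
  proof
    fix x y z
    show "p (x - y) = p (y - x)" by (rule pD)
    show "p (x - y) = 0 \<longleftrightarrow> x = y" if "x \<in> G" "y \<in> G"
      using definite[of "x - y"] GD that pD(1) by auto
    show "p (x - z) \<le> p (x - y) + p (y - z)"
      using pD(2)[of "x - y" "y - z"] by simp
  qed (rule pD)
  let ?T = "M.mtopology"
  have ball: "x \<in> M.mball x r" "openin ?T (M.mball x r)" if "x \<in> G" "0 < r" for x r
    using that pD(1) by auto
  have nhds: "nhds0 ?T U \<longleftrightarrow> U \<subseteq> G \<and> (\<exists>r>0. {x\<in>G. p x < r} \<subseteq> U)" for U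
  proof -
    have ball0: "M.mball 0 r = {x\<in>G. p x < r}" for r
      using GD(1) pD(6) by auto
    show ?thesis
    proof
      assume "nhds0 ?T U"
      then obtain V where V: "openin ?T V" "0 \<in> V" "V \<subseteq> U" "U \<subseteq> G"
        by (auto simp: nhds0_def)
      then obtain r where "0 < r" "M.mball 0 r \<subseteq> V"
        unfolding M.openin_mtopology by blast
      with V show "U \<subseteq> G \<and> (\<exists>r>0. {x\<in>G. p x < r} \<subseteq> U)"
        unfolding ball0[symmetric] by blast
    next
      assume "U \<subseteq> G \<and> (\<exists>r>0. {x\<in>G. p x < r} \<subseteq> U)"
      then show "nhds0 ?T U"
        unfolding nhds0_def M.topspace_mtopology ball0[symmetric]
        using ball[of 0] GD(1) by blast
    qed
  qed
  have add: "continuous_map (prod_topology ?T ?T) ?T (\<lambda>(x, y). x + y)"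
    unfolding M.continuous_map_to_metric
  proof (intro ballI allI impI)
    fix z and e :: real assume z: "z \<in> topspace (prod_topology ?T ?T)" and "0 < e"
    obtain x y where xy: "z = (x, y)" "x \<in> G" "y \<in> G" using z by auto
    have "x' + y' \<in> M.mball (x + y) e" if "x' \<in> M.mball x (e/2)" "y' \<in> M.mball y (e/2)" for x' y'
      using pD(2)[of "x - x'" "y - y'"] that by (auto simp: algebra_simps GD)
    with ball[of x "e/2"] ball[of y "e/2"] xy \<open>0 < e\<close>
    show "\<exists>U. openin (prod_topology ?T ?T) U \<and> z \<in> U \<and>
      (\<forall>w\<in>U. (case w of (x, y) \<Rightarrow> x + y) \<in> M.mball (case z of (x, y) \<Rightarrow> x + y) e)"
      by (intro exI[of _ "M.mball x (e/2) \<times> M.mball y (e/2)"]) (auto simp: openin_prod_Times_iff simp del: M.in_mball)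
  qed
  have scale: "continuous_map (prod_topology euclideanreal ?T) ?T (\<lambda>(c, x). c *\<^sub>R x)"
    unfolding M.continuous_map_to_metric
  proof (intro ballI allI impI)
    fix z and e :: real assume z: "z \<in> topspace (prod_topology euclideanreal ?T)" and "0 < e"
    obtain c x where cx: "z = (c, x)" "x \<in> G" using z by auto
    obtain \<delta> where \<delta>: "0 < \<delta>" "\<And>b. \<bar>b\<bar> < \<delta> \<Longrightarrow> p (b *\<^sub>R x) < e/2"
      using pD(4)[of "e/2" x] \<open>0 < e\<close> by auto
    \<comment> \<open>\<open>n\<close> bounds \<open>\<bar>b\<bar>\<close> for all \<open>b\<close>
      within \<open>\<delta>\<close> of \<open>c\<close>. The radius \<open>r\<close> is chosen so
      that \<open>b *\<^sub>R (x - y)\<close> contributes at most \<open>e / 2\<close>.\<close>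
    obtain n where n: "\<bar>c\<bar> + \<delta> \<le> real n" "0 < n"
      using reals_Archimedean2[of "\<bar>c\<bar> + \<delta>"] \<open>0 < \<delta>\<close>
      by (metis abs_ge_zero add_nonneg_pos le_less_trans less_imp_le of_nat_0_less_iff order.strict_trans)
    define r where "r = e / (2 * real n)"
    have r: "0 < r" "real n * r = e / 2"
      using \<open>0 < e\<close> \<open>0 < n\<close> by (auto simp: r_def)
    have "b *\<^sub>R y \<in> M.mball (c *\<^sub>R x) e" if b: "c - \<delta> < b" "b < c + \<delta>" and y: "y \<in> M.mball x r" for b y
    proof -
      have "p (c *\<^sub>R x - b *\<^sub>R y) \<le> p (b *\<^sub>R (x - y)) + p ((c - b) *\<^sub>R x)"
        using pD(2)[of "b *\<^sub>R (x - y)" "(c - b) *\<^sub>R x"] by (simp add: algebra_simps)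
      also have "p (b *\<^sub>R (x - y)) \<le> real n * p (x - y)"
        using b n by (intro riesz_pseudonorm_scaleR_nat[OF p]) auto
      also have "\<dots> \<le> real n * r"
        using y by (intro mult_left_mono) auto
      also have "p ((c - b) *\<^sub>R x) < e / 2"
        using b by (intro \<delta>) auto
      finally show ?thesis
        using y cx(2) r by (auto simp: GD)
    qed
    with ball[of x r] cx \<delta>(1) r(1)
    show "\<exists>U. openin (prod_topology euclideanreal ?T) U \<and> z \<in> U \<and>
      (\<forall>w\<in>U. (case w of (c, x) \<Rightarrow> c *\<^sub>R x) \<in> M.mball (case z of (c, x) \<Rightarrow> c *\<^sub>R x) e)"
      by (intro exI[of _ "{c - \<delta><..<c + \<delta>} \<times> M.mball x r"])
        (auto simp: openin_prod_Times_iff simp del: M.in_mball)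
  qed
  show thesis
  proof
    show "locally_solid_on G ?T"
      unfolding locally_solid_on_def linear_topology_on_def
    proof (intro conjI allI impI add scale M.topspace_mtopology GD(1) M.Hausdorff_space_mtopology)
      fix U assume "nhds0 ?T U"
      then obtain r where r: "0 < r" "{x\<in>G. p x < r} \<subseteq> U"
        unfolding nhds by blast
      show "\<exists>V. nhds0 ?T V \<and> solid_in G V \<and> V \<subseteq> U"
      proof (intro exI conjI)
        show "solid_in G {x\<in>G. p x < r}"
          using pD(3) le_less_trans unfolding solid_in_def by blast
        show "nhds0 ?T {x\<in>G. p x < r}"
          using r(1) unfolding nhds by blast
      qed (rule r)
    qed
    show "metrizable_space ?T" by (rule M.metrizable_space_mtopology)
    show "openin ?T U \<longleftrightarrow> U \<subseteq> G \<and> (\<forall>x\<in>U. \<exists>r>0. \<forall>y\<in>G. p (y - x) < r \<longrightarrow> y \<in> U)" for U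
      unfolding M.openin_mtopology M.mball_def using pD(7) by (fastforce simp: subset_iff)
    show "nhds0 ?T U \<longleftrightarrow> U \<subseteq> G \<and> (\<exists>r>0. {x\<in>G. p x < r} \<subseteq> U)" for U
      by (rule nhds)
    show "limitin ?T s l sequentially" if "range s \<subseteq> G" "l \<in> G" "(\<lambda>n. p (s n - l)) \<longlonglongrightarrow> 0" for s l
      unfolding M.limitin_metric using that order_tendstoD(2)[OF that(3)]
      by (auto simp: image_subset_iff elim!: eventually_mono)
  qed
qed

section \<open>Neighbourhoods of zero in locally solid topologies\<close>

lemma locally_solid_topspace: "locally_solid_on G T \<Longrightarrow> topspace T = G"
  by (simp add: locally_solid_on_def linear_topology_on_def)

lemma nhds0_openin:
  assumes "nhds0 T U"
  obtains V where "openin T V" "0 \<in> V" "V \<subseteq> U"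
  using assms by (auto simp: nhds0_def)

lemma nhds0_zero: "nhds0 T U \<Longrightarrow> 0 \<in> U"
  by (auto simp: nhds0_def)

lemma nhds0_Int: "nhds0 T U \<Longrightarrow> nhds0 T V \<Longrightarrow> nhds0 T (U \<inter> V)"
  unfolding nhds0_def by (meson IntI Int_mono inf.coboundedI1 openin_Int)

lemma nhds0_INT:
  assumes "finite I" "I \<noteq> {}" "\<And>i. i \<in> I \<Longrightarrow> nhds0 T (U i)"
  shows "nhds0 T (\<Inter>i\<in>I. U i)"
  using assms by (induction I rule: finite_ne_induct) (simp_all add: nhds0_Int)

lemma nhds0_open: "openin T U \<Longrightarrow> 0 \<in> U \<Longrightarrow> nhds0 T U"
  unfolding nhds0_def using openin_subset by blast

lemma nhds0_mono: "nhds0 T U \<Longrightarrow> U \<subseteq> V \<Longrightarrow> V \<subseteq> topspace T \<Longrightarrow> nhds0 T V"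
  unfolding nhds0_def by blast

lemma nhds0_add:
  assumes "linear_topology_on G T" "nhds0 T U"
  obtains V where "nhds0 T V" "\<And>x y. x \<in> V \<Longrightarrow> y \<in> V \<Longrightarrow> x + y \<in> U"
proof -
  obtain O' where O: "openin T O'" "0 \<in> O'" "O' \<subseteq> U" using assms(2) by (rule nhds0_openin)
  have "openin (prod_topology T T) {z \<in> topspace (prod_topology T T). (case z of (x, y) \<Rightarrow> x + y) \<in> O'}"
    using assms(1) O(1) unfolding linear_topology_on_def by (blast intro: openin_continuous_map_preimage)
  moreover have "(0, 0) \<in> {z \<in> topspace (prod_topology T T). (case z of (x, y) \<Rightarrow> x + y) \<in> O'}"
    using O assms(1) by (simp add: linear_topology_on_def)
  ultimately obtain A B where AB: "openin T A" "openin T B" "0 \<in> A" "0 \<in> B"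
    "A \<times> B \<subseteq> {z \<in> topspace (prod_topology T T). (case z of (x, y) \<Rightarrow> x + y) \<in> O'}"
    unfolding openin_prod_topology_alt by meson
  show thesis
  proof
    show "nhds0 T (A \<inter> B)" using AB by (intro nhds0_Int nhds0_open)
    show "x + y \<in> U" if "x \<in> A \<inter> B" "y \<in> A \<inter> B" for x y
      using AB(5) O(3) that by auto
  qed
qed

lemma nhds0_absorbing:
  assumes "linear_topology_on G T" "nhds0 T U" "x \<in> G"
  shows "\<exists>\<delta>>0. \<forall>c. \<bar>c\<bar> < \<delta> \<longrightarrow> c *\<^sub>R x \<in> U"
proof -
  obtain O' where O: "openin T O'" "0 \<in> O'" "O' \<subseteq> U" using assms(2) by (rule nhds0_openin)
  let ?P = "{z \<in> topspace (prod_topology euclideanreal T). (case z of (c, x) \<Rightarrow> c *\<^sub>R x) \<in> O'}"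
  have "openin (prod_topology euclideanreal T) ?P"
    using assms(1) O(1) unfolding linear_topology_on_def by (blast intro: openin_continuous_map_preimage)
  moreover have "(0, x) \<in> ?P"
    using O assms by (simp add: linear_topology_on_def)
  ultimately obtain A B where AB: "open A" "0 \<in> A" "x \<in> B" "A \<times> B \<subseteq> ?P"
    unfolding openin_prod_topology_alt open_openin[symmetric] by meson
  have "\<exists>\<delta>>0. \<forall>c. dist c 0 < \<delta> \<longrightarrow> c \<in> A"
    using AB(1,2) by (simp only: open_dist)
  then obtain \<delta> where "0 < \<delta>" "\<And>c. dist c 0 < \<delta> \<Longrightarrow> c \<in> A"
    by blast
  moreover have "c *\<^sub>R x \<in> U" if "c \<in> A" for c
    using AB(3,4) O(3) that by fastforce
  ultimately show ?thesis
    by (intro exI[of _ \<delta>]) simp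
qed

lemma open_translate_nhds0:
  assumes "linear_topology_on UNIV T" "nhds0 T U"
  obtains V where "openin T V" "x \<in> V" "\<And>y. y \<in> V \<Longrightarrow> y - x \<in> U"
proof -
  obtain O' where O: "openin T O'" "0 \<in> O'" "O' \<subseteq> U" using assms(2) by (rule nhds0_openin)
  have top: "topspace T = UNIV" using assms(1) by (simp add: linear_topology_on_def)
  have "continuous_map T (prod_topology T T) (\<lambda>y. (y, - x))"
    by (simp add: continuous_map_paired top)
  moreover have "continuous_map (prod_topology T T) T (\<lambda>(x, y). x + y)"
    using assms(1) by (simp add: linear_topology_on_def)
  ultimately have "continuous_map T T ((\<lambda>(x, y). x + y) \<circ> (\<lambda>y. (y, - x)))"
    by (rule continuous_map_compose)
  then have "continuous_map T T (\<lambda>y. y - x)"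
    by (simp add: comp_def)
  then have "openin T {y \<in> topspace T. y - x \<in> O'}"
    using O(1) by (rule openin_continuous_map_preimage)
  with O top show thesis
    by (intro that[of "{y. y - x \<in> O'}"]) auto
qed

lemma nhds0_subtopology:
  assumes "nhds0 (subtopology T G) U"
  obtains V where "nhds0 T V" "V \<inter> G \<subseteq> U"
proof -
  from assms obtain W where "openin T W" "0 \<in> W \<inter> G" "W \<inter> G \<subseteq> U"
    unfolding nhds0_def openin_subtopology by blast
  then show thesis by (intro that[of W] nhds0_open) auto
qed

lemma nhds0_subtopologyI:
  assumes "nhds0 T V" "0 \<in> G"
  shows "nhds0 (subtopology T G) (V \<inter> G)"
proof -
  from assms(1) obtain W where W: "openin T W" "0 \<in> W" "W \<subseteq> V" by (rule nhds0_openin)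
  have "nhds0 (subtopology T G) (W \<inter> G)"
    using W assms(2) by (intro nhds0_open openin_subtopology_Int) auto
  moreover have "V \<inter> G \<subseteq> topspace (subtopology T G)"
    using assms(1) by (auto simp: nhds0_def)
  ultimately show ?thesis
    using W(3) by (blast intro: nhds0_mono)
qed

lemma locally_solid_on_subtopology:
  assumes T: "locally_solid T" and G: "solid_subspace G"
  shows "locally_solid_on G (subtopology T G)"
proof -
  note GD = solid_subspaceD(1-3)[OF G]
  have top: "topspace T = UNIV" using T by (rule locally_solid_topspace)
  have add: "continuous_map (prod_topology T T) T (\<lambda>(x, y). x + y)"
    and scale: "continuous_map (prod_topology euclideanreal T) T (\<lambda>(c, x). c *\<^sub>R x)"
    and T2: "Hausdorff_space T"
    using T by (simp_all add: locally_solid_on_def linear_topology_on_def)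
  show ?thesis
    unfolding locally_solid_on_def linear_topology_on_def
  proof (intro conjI allI impI)
    show "continuous_map (prod_topology (subtopology T G) (subtopology T G)) (subtopology T G) (\<lambda>(x, y). x + y)"
      using continuous_map_from_subtopology[OF add]
      by (auto simp: GD continuous_map_in_subtopology top simp flip: subtopology_Times)
    have "prod_topology euclideanreal (subtopology T G) = subtopology (prod_topology euclideanreal T) (UNIV \<times> G)"
      by (simp add: subtopology_Times)
    then show "continuous_map (prod_topology euclideanreal (subtopology T G)) (subtopology T G) (\<lambda>(c, x). c *\<^sub>R x)"
      using continuous_map_from_subtopology[OF scale]
      by (auto simp: GD continuous_map_in_subtopology top)
    fix U assume "nhds0 (subtopology T G) U"
    then obtain V where "nhds0 T V" "V \<inter> G \<subseteq> U" by (rule nhds0_subtopology)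
    moreover then obtain W where "nhds0 T W" "solid_in UNIV W" "W \<subseteq> V"
      using T unfolding locally_solid_on_def by blast
    ultimately show "\<exists>W. nhds0 (subtopology T G) W \<and> solid_in G W \<and> W \<subseteq> U"
      using nhds0_subtopologyI[OF _ GD(1)]
      by (intro exI[of _ "W \<inter> G"]) (auto simp: solid_in_def)
  qed (use GD(1) T2 top in \<open>simp_all add: Hausdorff_space_subtopology\<close>)
qed

section \<open>Normal sequences, their refinements and their pseudonorms\<close>

lemma normal_seqD:
  assumes "normal_seq T V"
  shows "nhds0 T (V n)" "x \<in> V n \<Longrightarrow> vabs y \<le> vabs x \<Longrightarrow> y \<in> V n"
    "x \<in> V (Suc n) \<Longrightarrow> y \<in> V (Suc n) \<Longrightarrow> x + y \<in> V n" "0 \<in> V n" "solid_in UNIV (V n)"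
    "m \<le> n \<Longrightarrow> V n \<subseteq> V m" "x \<in> V n \<Longrightarrow> - x \<in> V n" "x \<in> V (Suc n) \<Longrightarrow> y \<in> V (Suc n) \<Longrightarrow> x - y \<in> V n"
proof -
  show nhds: "nhds0 T (V n)" for n using assms by (simp add: normal_seq_def)
  show zero: "0 \<in> V n" for n using nhds by (rule nhds0_zero)
  show solid: "x \<in> V n \<Longrightarrow> vabs y \<le> vabs x \<Longrightarrow> y \<in> V n" for x y n
    using assms unfolding normal_seq_def solid_in_def by blast
  show minus: "x \<in> V n \<Longrightarrow> - x \<in> V n" for x n
    by (erule solid) simp
  show "solid_in UNIV (V n)" using assms by (simp add: normal_seq_def)
  show add: "x \<in> V (Suc n) \<Longrightarrow> y \<in> V (Suc n) \<Longrightarrow> x + y \<in> V n" for x y n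
    using assms unfolding normal_seq_def by blast
  show "x \<in> V (Suc n) \<Longrightarrow> y \<in> V (Suc n) \<Longrightarrow> x - y \<in> V n"
    using add[of x n "- y"] minus[of y "Suc n"] by simp
  show "m \<le> n \<Longrightarrow> V n \<subseteq> V m"
  proof (rule lift_Suc_antimono_le)
    show "V (Suc i) \<subseteq> V i" for i using add[OF _ zero] by auto
  qed
qed

text \<open>Dependent choice: continuity of addition supplies the next set inside the previous one,
  intersected with \<open>U (Suc n)\<close>. The predicate \<open>P\<close> lets one construction
  yield both solid and order closed members.\<close>

lemma normal_seq_refine:
  assumes T: "locally_solid T" and U: "\<And>n. nhds0 T (U n)"
    and P: "\<And>W. nhds0 T W \<Longrightarrow> \<exists>V. nhds0 T V \<and> solid_in UNIV V \<and> P V \<and> V \<subseteq> W"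
  obtains V where "normal_seq T V" "\<And>n. V n \<subseteq> U n" "\<And>n. P (V n)"
proof -
  have lin: "linear_topology_on UNIV T" using T by (simp add: locally_solid_on_def)
  let ?A = "\<lambda>n V. nhds0 T V \<and> solid_in UNIV V \<and> P V \<and> V \<subseteq> U n"
  have "\<exists>V. \<forall>n. ?A n (V n) \<and> (\<forall>x\<in>V (Suc n). \<forall>y\<in>V (Suc n). x + y \<in> V n)"
  proof (rule dependent_nat_choice)
    show "\<exists>V. ?A 0 V" using P U by blast
    fix V n assume V: "?A n V"
    then obtain W where W: "nhds0 T W" "\<And>x y. x \<in> W \<Longrightarrow> y \<in> W \<Longrightarrow> x + y \<in> V"
      using nhds0_add[OF lin] by blast
    have "nhds0 T (W \<inter> U (Suc n))" by (intro nhds0_Int W U)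
    with P obtain V' where "nhds0 T V'" "solid_in UNIV V'" "P V'" "V' \<subseteq> W \<inter> U (Suc n)" by blast
    with W(2) show "\<exists>V'. ?A (Suc n) V' \<and> (\<forall>x\<in>V'. \<forall>y\<in>V'. x + y \<in> V)" by blast
  qed
  then obtain V where "\<And>n. ?A n (V n) \<and> (\<forall>x\<in>V (Suc n). \<forall>y\<in>V (Suc n). x + y \<in> V n)" by blast
  then show thesis
    by (intro that[of V]) (auto simp: normal_seq_def)
qed

lemma normal_seq_refine_solid:
  assumes "locally_solid T" "\<And>n. nhds0 T (U n)"
  obtains V where "normal_seq T V" "\<And>n. V n \<subseteq> U n"
proof (rule normal_seq_refine[OF assms(1), of U "\<lambda>_. True"])
  show "nhds0 T (U n)" for n by (rule assms)
  show "\<exists>V. nhds0 T V \<and> solid_in UNIV V \<and> True \<and> V \<subseteq> W" if "nhds0 T W" for W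
    using assms(1) that unfolding locally_solid_on_def by blast
qed (use that in \<open>auto\<close>)

lemma normal_seq_refine_order_closed:
  assumes "fatou T" "\<And>n. nhds0 T (U n)"
  obtains V where "normal_seq T V" "\<And>n. V n \<subseteq> U n" "\<And>n. order_closed (V n)"
  using normal_seq_refine[of T U order_closed] assms unfolding fatou_def by auto

text \<open>Membership in every \<open>V (Suc n)\<close> puts sums in every \<open>V n\<close>;
  scalars are again reached through integer multiples and solidity.\<close>

lemma solid_subspace_INT_normal_seq:
  assumes T: "locally_solid T" and V: "normal_seq T V"
  shows "solid_subspace (\<Inter>n. V n)"
  unfolding solid_subspace_def
proof (intro conjI ballI allI impI)
  note VD = normal_seqD[OF V]
  show "0 \<in> (\<Inter>n. V n)" using VD(4) by blast
  show add: "x + y \<in> (\<Inter>n. V n)" if "x \<in> (\<Inter>n. V n)" "y \<in> (\<Inter>n. V n)" for x y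
    using that VD(3) by blast
  show solid: "y \<in> (\<Inter>n. V n)" if "x \<in> (\<Inter>n. V n)" "vabs y \<le> vabs x" for x y
    using that VD(2) by blast
  show "c *\<^sub>R x \<in> (\<Inter>n. V n)" if x: "x \<in> (\<Inter>n. V n)" for c x
  proof -
    have n: "real n *\<^sub>R x \<in> (\<Inter>n. V n)" for n
      using x VD(4) by (induction n) (simp, simp only: of_nat_Suc scaleR_left_distrib scaleR_one add)
    obtain n where n_ge: "\<bar>c\<bar> \<le> real n" and "0 < n"
      using reals_Archimedean2[of "\<bar>c\<bar>"] by (metis abs_ge_zero le_less_trans less_imp_le of_nat_0_less_iff)
    have "c *\<^sub>R x = (c / n) *\<^sub>R (real n *\<^sub>R x)"
      using \<open>0 < n\<close> by simp
    then show ?thesis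
      using solid[OF n[of n], of "c *\<^sub>R x"] n_ge \<open>0 < n\<close> vabs_scaleR_le_vabs[of "c / n" "real n *\<^sub>R x"]
      by simp
  qed
qed

lemma normal_seq_pseudonorm:
  assumes T: "locally_solid T" and V: "normal_seq T V"
  obtains p where "riesz_pseudonorm p" "\<And>n x. p x < 1 / 2 ^ n \<Longrightarrow> x \<in> V n"
    "\<And>n x. x \<in> V (2 * n) \<Longrightarrow> p x \<le> 1 / 2 ^ n"
proof -
  note VD = normal_seqD[OF V]
  have lin: "linear_topology_on UNIV T" using T by (simp add: locally_solid_on_def)
  \<comment> \<open>The pseudonorm construction needs sums of three vectors, hence two halvings per
    step; every second member of the sequence provides them.\<close>
  let ?W = "\<lambda>n. V (2 * n)"
  have "\<exists>p. riesz_pseudonorm p \<and> (\<forall>n x. p x < 1 / 2 ^ n \<longrightarrow> x \<in> ?W n) \<and> (\<forall>n x. x \<in> ?W n \<longrightarrow> p x \<le> 1 / 2 ^ n)"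
  proof (rule riesz_pseudonorm_of_seq)
    show "a + b + c \<in> ?W n" if "a \<in> ?W (Suc n)" "b \<in> ?W (Suc n)" "c \<in> ?W (Suc n)" for n a b c
    proof (rule VD(3))
      show "a + b \<in> V (Suc (2 * n))" using that VD(3) by simp
      show "c \<in> V (Suc (2 * n))" using that VD(6)[of "Suc (2 * n)" "2 * Suc n"] by auto
    qed
  qed (use VD(4,5) nhds0_absorbing[OF lin VD(1)] in auto)
  moreover have "V (2 * n) \<subseteq> V n" for n by (rule VD(6)) simp
  ultimately show thesis using that by blast
qed

text \<open>The kernel of the pseudonorm of \<open>V\<close> lies in the intersection of the
  \<open>V n\<close>, so \<open>separating\<close> makes it definite on \<open>G\<close>. Every ball
  contains the trace of a translate of some \<open>V (2 * n)\<close>, whence the topology is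
  coarser. The last two conclusions translate Cauchy conditions and limits into the
  \<open>V n\<close>.\<close>

lemma normal_seq_metrisable:
  assumes T: "locally_solid T" and V: "normal_seq T V" and G: "solid_subspace G"
    and separating: "(\<Inter>n. V n) \<inter> G = {0}"
  obtains T' where "locally_solid_on G T'" "metrizable_space T'" "finer_than (subtopology T G) T'"
    "\<And>n. nhds0 T' (V n \<inter> G)"
    "\<And>s l. range s \<subseteq> G \<Longrightarrow> l \<in> G \<Longrightarrow> (\<And>n. \<forall>\<^sub>F k in sequentially. s k - l \<in> V n) \<Longrightarrow>
      limitin T' s l sequentially"
proof -
  have lin: "linear_topology_on UNIV T" using T by (simp add: locally_solid_on_def)
  obtain p where p: "riesz_pseudonorm p" and pV: "\<And>n x. p x < 1 / 2 ^ n \<Longrightarrow> x \<in> V n"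
    and Vp: "\<And>n x. x \<in> V (2 * n) \<Longrightarrow> p x \<le> 1 / 2 ^ n"
    using normal_seq_pseudonorm[OF T V] by blast
  have small: "\<exists>n. \<forall>x\<in>V (2 * n). p x < r" if "0 < r" for r
  proof -
    obtain n where "(1/2) ^ n < r" using real_arch_pow_inv[of r "1/2"] \<open>0 < r\<close> by auto
    with Vp show ?thesis by (intro exI[of _ n]) (fastforce simp: power_divide)
  qed
  have definite: "x = 0" if "x \<in> G" "p x = 0" for x
    using that pV[of x] separating by auto
  obtain T' where T': "locally_solid_on G T'" "metrizable_space T'"
    "\<And>U. openin T' U \<longleftrightarrow> U \<subseteq> G \<and> (\<forall>x\<in>U. \<exists>r>0. \<forall>y\<in>G. p (y - x) < r \<longrightarrow> y \<in> U)"
    "\<And>U. nhds0 T' U \<longleftrightarrow> U \<subseteq> G \<and> (\<exists>r>0. {x\<in>G. p x < r} \<subseteq> U)"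
    "\<And>s l. range s \<subseteq> G \<Longrightarrow> l \<in> G \<Longrightarrow> (\<lambda>n. p (s n - l)) \<longlonglongrightarrow> 0 \<Longrightarrow> limitin T' s l sequentially"
    by (rule pseudonorm_topology[OF p G], erule (1) definite) (rule that; assumption)
  show thesis
  proof
    show "finer_than (subtopology T G) T'"
      unfolding finer_than_def
    proof (intro conjI allI impI)
      show "topspace (subtopology T G) = topspace T'"
        using T T'(1) by (simp add: locally_solid_topspace)
      fix U assume U: "openin T' U"
      show "openin (subtopology T G) U"
      proof (subst openin_subopen, intro ballI)
        fix x assume "x \<in> U"
        with U obtain r where r: "0 < r" "\<And>y. y \<in> G \<Longrightarrow> p (y - x) < r \<Longrightarrow> y \<in> U"
          unfolding T'(3) by blast
        obtain n where n: "\<And>z. z \<in> V (2 * n) \<Longrightarrow> p z < r" using small[OF r(1)] by blast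
        obtain O' where O: "openin T O'" "x \<in> O'" "\<And>y. y \<in> O' \<Longrightarrow> y - x \<in> V (2 * n)"
          using open_translate_nhds0[OF lin normal_seqD(1)[OF V]] by blast
        show "\<exists>S. openin (subtopology T G) S \<and> x \<in> S \<and> S \<subseteq> U"
          using O r n \<open>x \<in> U\<close> U unfolding T'(3) openin_subtopology
          by (intro exI[of _ "O' \<inter> G"]) blast
      qed
    qed
    show "nhds0 T' (V n \<inter> G)" for n
      unfolding T'(4) using pV[of _ n] by (auto intro!: exI[of _ "1 / 2 ^ n"])
    show "limitin T' s l sequentially" if s: "range s \<subseteq> G" "l \<in> G"
      "\<And>n. \<forall>\<^sub>F k in sequentially. s k - l \<in> V n" for s l
    proof (rule T'(5)[OF s(1,2)])
      show "(\<lambda>n. p (s n - l)) \<longlonglongrightarrow> 0"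
      proof (rule order_tendstoI)
        fix r :: real assume "0 < r"
        then obtain n where "\<And>z. z \<in> V (2 * n) \<Longrightarrow> p z < r" using small by blast
        with s(3)[of "2 * n"] show "\<forall>\<^sub>F k in sequentially. p (s k - l) < r"
          by (auto elim!: eventually_mono)
      next
        fix r :: real assume "r < 0"
        then show "\<forall>\<^sub>F k in sequentially. r < p (s k - l)"
          by (auto intro!: always_eventually less_le_trans[OF _ riesz_pseudonormD(5)[OF p]])
      qed
    qed
  qed (use T' in auto)
qed


section \<open>Order convergence of directed sets\<close>

definition up_directed :: "'a::order set \<Rightarrow> bool" where
  "up_directed S \<longleftrightarrow> S \<noteq> {} \<and> (\<forall>a\<in>S. \<forall>b\<in>S. \<exists>c\<in>S. a \<le> c \<and> b \<le> c)"

text \<open>The section filter of \<open>S\<close>, regarded as an increasing net indexed by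
  itself.\<close>

definition tail_filter :: "'a::order set \<Rightarrow> 'a filter" where
  "tail_filter S = (INF y\<in>S. principal {z \<in> S. y \<le> z})"

lemma eventually_tail_filter:
  assumes "up_directed S"
  shows "eventually P (tail_filter S) \<longleftrightarrow> (\<exists>y\<in>S. \<forall>z\<in>S. y \<le> z \<longrightarrow> P z)"
  unfolding tail_filter_def
proof (subst eventually_INF_base)
  show "S \<noteq> {}" using assms by (simp add: up_directed_def)
  fix a b assume "a \<in> S" "b \<in> S"
  then obtain c where "c \<in> S" "a \<le> c" "b \<le> c"
    using assms unfolding up_directed_def by blast
  then show "\<exists>x\<in>S. principal {z \<in> S. x \<le> z} \<le> inf (principal {z \<in> S. a \<le> z}) (principal {z \<in> S. b \<le> z})"
    by (intro bexI[of _ c]) (auto intro: order_trans)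
qed (auto simp: eventually_principal)

lemma tail_filter_nontrivial: "up_directed S \<Longrightarrow> tail_filter S \<noteq> bot"
  unfolding trivial_limit_def by (simp add: eventually_tail_filter) auto

lemma tail_filter_order_conv:
  fixes S :: "'a::{ordered_real_vector,lattice} set"
  assumes S: "up_directed S" and s: "is_sup S s"
  shows "order_conv (tail_filter S) s"
  unfolding order_conv_def
proof (intro exI conjI ballI)
  \<comment> \<open>The distances to the supremum form the decreasing family that dominates the
    tails.\<close>
  let ?D = "(\<lambda>y. s - y) ` S"
  show "?D \<noteq> {}" using S by (simp add: up_directed_def)
  show "\<exists>c\<in>?D. c \<le> a \<and> c \<le> b" if ab: "a \<in> ?D" "b \<in> ?D" for a b
  proof -
    obtain a' b' where "a' \<in> S" "b' \<in> S" "a = s - a'" "b = s - b'" using ab by blast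
    moreover then obtain c where "c \<in> S" "a' \<le> c" "b' \<le> c"
      using S unfolding up_directed_def by blast
    ultimately show ?thesis by (intro bexI[of _ "s - c"]) (auto intro: diff_left_mono)
  qed
  show "is_inf ?D 0"
    unfolding is_inf_def
  proof (intro conjI ballI allI impI)
    show "0 \<le> d" if "d \<in> ?D" for d
      using that s by (auto simp: is_sup_def)
    fix z assume z: "\<forall>d\<in>?D. z \<le> d"
    have "y \<le> s - z" if "y \<in> S" for y
      using z that by (auto simp: le_diff_eq add.commute)
    then have "s \<le> s - z" using s by (simp add: is_sup_def)
    then show "z \<le> 0" by (simp add: le_diff_eq)
  qed
  show "eventually (\<lambda>y. vabs (y - s) \<le> d) (tail_filter S)" if d: "d \<in> ?D" for d
  proof -
    obtain a where a: "a \<in> S" "d = s - a" using d by blast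
    have "vabs (y - s) \<le> d" if "y \<in> S" "a \<le> y" for y
    proof -
      have "y \<le> s" using s that by (simp add: is_sup_def)
      then show ?thesis
        using that a by (simp add: vabs_minus_commute[of y s] diff_left_mono)
    qed
    with a(1) show ?thesis by (auto simp: eventually_tail_filter[OF S])
  qed
qed

lemma order_closed_is_sup:
  fixes S :: "'a::{ordered_real_vector,lattice} set"
  assumes "order_closed A" "up_directed S" "is_sup S s" "S \<subseteq> A"
  shows "s \<in> A"
proof -
  have "eventually (\<lambda>y. y \<in> A) (tail_filter S)"
    using assms(2,4) by (auto simp: eventually_tail_filter up_directed_def)
  with assms tail_filter_nontrivial tail_filter_order_conv show ?thesis
    unfolding order_closed_def by blast
qed

lemma order_closed_INT: "(\<And>i. i \<in> I \<Longrightarrow> order_closed (A i)) \<Longrightarrow> order_closed (\<Inter>i\<in>I. A i)"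
  unfolding order_closed_def by (blast intro: eventually_mono)

lemma up_directed_range_incseq:
  fixes w :: "nat \<Rightarrow> 'a::order"
  assumes "incseq w"
  shows "up_directed (range w)"
proof -
  have "w m \<le> w (max m n)" "w n \<le> w (max m n)" for m n
    using assms by (auto simp: incseq_def)
  then show ?thesis unfolding up_directed_def by blast
qed

section \<open>Interval completeness of Fatou topologies\<close>

text \<open>Nakano: for a rapidly Cauchy sequence \<open>u\<close>, the infima of the tails differ little from \<open>u\<close>,
  and they increase to the limit.\<close>

lemma fatou_interval_Cauchy_converges:
  fixes s :: "nat \<Rightarrow> 'b::{ordered_real_vector,conditionally_complete_lattice}"
  assumes V: "normal_seq T V" and closed: "\<And>n. order_closed (V n)"
    and bounds: "\<And>n. 0 \<le> s n" "\<And>n. s n \<le> x"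
    and cauchy: "\<And>n. \<exists>N. \<forall>i\<ge>N. \<forall>j\<ge>N. s i - s j \<in> V n"
  shows "\<exists>l\<in>{0..x}. \<forall>n. \<forall>\<^sub>F k in sequentially. s k - l \<in> V n"
proof -
  note VD = normal_seqD[OF V]
  have antiD: "z \<in> V m" if "z \<in> V n" "m \<le> n" for z m n
    using VD(6)[OF that(2)] that(1) by blast
  obtain N where N: "\<And>n i j. N n \<le> i \<Longrightarrow> N n \<le> j \<Longrightarrow> s i - s j \<in> V n"
    using cauchy by metis
  \<comment> \<open>Partial sums of \<open>N\<close> turn all thresholds up to \<open>Suc k\<close>
    into one index; the term at \<open>Suc k\<close> is what puts consecutive differences of
    \<open>u\<close> into \<open>V (Suc k)\<close>.\<close>
  define r where "r k = (\<Sum>i\<le>Suc k. N i)" for k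
  have r_ge: "N n \<le> r k" if "n \<le> Suc k" for n k
    unfolding r_def using that by (intro member_le_sum) auto
  define u where "u k = s (r k)" for k
  have u_diff: "u i - u j \<in> V n" if "n \<le> Suc i" "n \<le> Suc j" for i j n
    unfolding u_def using that by (intro N r_ge)
  have u_step: "u k - u (Suc k) \<in> V (Suc k)" for k
    by (rule u_diff) simp_all
  have u: "0 \<le> u k" "u k \<le> x" for k by (simp_all add: u_def bounds)
  have bdd: "bdd_below (u ` A)" for A
    using u by (intro bdd_belowI[of _ 0]) auto
  \<comment> \<open>Finite segments come first, since induction reaches them; order closedness then
    carries the estimate to the infima \<open>w\<close> of whole tails.\<close>
  define a where "a k m = Inf (u ` {k..k+m})" for k m
  \<comment> \<open>The difference \<open>u k - ?b\<close> splits into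
    \<open>u k - u (Suc k)\<close> and \<open>u (Suc k) - ?b\<close>, both in
    \<open>V (Suc k)\<close>. Replacing \<open>?b\<close> by its infimum with \<open>u k\<close>
    only brings it closer to \<open>u k\<close>. The start \<open>k\<close> of the segment has to
    vary in the induction.\<close>
  have a: "u k - a k m \<in> V k" for k m
  proof (induction m arbitrary: k)
    case 0
    then show ?case by (simp add: a_def VD(4))
  next
    case (Suc m)
    let ?b = "a (Suc k) m"
    have "{k..k + Suc m} = insert k {Suc k..Suc k + m}" by auto
    then have "a k (Suc m) = inf (u k) ?b"
      unfolding a_def using bdd[of "{Suc k..Suc k + m}"] by (simp add: cInf_insert)
    moreover have "vabs (u k - inf (u k) ?b) \<le> vabs (u k - ?b)"
    proof -
      have "u k - vabs (u k - ?b) \<le> ?b"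
        using vabs_upper(1)[of "u k - ?b"] by (simp add: algebra_simps)
      moreover have "u k - vabs (u k - ?b) \<le> u k"
        by (simp add: diff_le_eq)
      ultimately have "u k - vabs (u k - ?b) \<le> inf (u k) ?b"
        by (rule inf_greatest[rotated])
      then have "u k - inf (u k) ?b \<le> vabs (u k - ?b)"
        by (simp only: diff_le_eq add.commute)
      then show ?thesis by simp
    qed
    moreover have "u k - ?b \<in> V k"
      using VD(3)[OF u_step[of k] Suc[of "Suc k"]] by simp
    ultimately show ?case using VD(2) by metis
  qed
  define w where "w k = Inf (u ` {k..})" for k
  have w_lower: "w k \<le> u i" if "k \<le> i" for k i
    unfolding w_def using that by (intro cInf_lower bdd) auto
  have w_greatest: "z \<le> w k" if "\<And>i. k \<le> i \<Longrightarrow> z \<le> u i" for z k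
    unfolding w_def using that by (intro cInf_greatest) auto
  have w: "u k - w k \<in> V k" for k
  proof (rule order_closed_is_sup[OF closed])
    have "a k n \<le> a k m" if "m \<le> n" for m n
      unfolding a_def using that by (intro cInf_superset_mono bdd) auto
    then show "up_directed (range (\<lambda>m. u k - a k m))"
      by (intro up_directed_range_incseq incseq_SucI diff_left_mono) simp
    have a_ge: "w k \<le> a k m" for m
      unfolding a_def using w_lower by (intro cInf_greatest) auto
    have a_le: "a k m \<le> u (k + m)" for m
      unfolding a_def by (intro cInf_lower bdd) auto
    show "is_sup (range (\<lambda>m. u k - a k m)) (u k - w k)"
      unfolding is_sup_def
    proof (intro conjI ballI allI impI)
      show "d \<le> u k - w k" if "d \<in> range (\<lambda>m. u k - a k m)" for d
        using that a_ge by (auto intro: diff_left_mono)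
      fix z assume z: "\<forall>d\<in>range (\<lambda>m. u k - a k m). d \<le> z"
      have "u k - z \<le> u i" if "k \<le> i" for i
      proof -
        have "u k - a k (i - k) \<le> z" using z by blast
        then have "u k - z \<le> a k (i - k)" by (simp add: algebra_simps)
        also have "\<dots> \<le> u i" using a_le[of "i - k"] that by simp
        finally show ?thesis .
      qed
      then have "u k - z \<le> w k" by (rule w_greatest)
      then show "u k - w k \<le> z" by (simp add: algebra_simps)
    qed
  qed (use a in auto)
  have w_mono: "incseq w"
    by (intro incseq_SucI w_greatest w_lower) simp
  have w_bounds: "0 \<le> w k" "w k \<le> x" for k
    using w_greatest[of k 0] u(1) order_trans[OF w_lower[of k k] u(2)] by auto
  define l where "l = Sup (range w)"
  have bdd_w: "bdd_above (range w)"
    using w_bounds by (intro bdd_aboveI[of _ x]) auto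
  have w_le: "w k \<le> l" for k
    unfolding l_def by (intro cSup_upper bdd_w) auto
  have l_least: "l \<le> z" if "\<And>i. w i \<le> z" for z
    unfolding l_def using that by (intro cSup_least) auto
  \<comment> \<open>The differences \<open>w (k + m) - w k\<close> are compared through
    \<open>u\<close>, which costs two halvings; hence the shift by two. Order closedness gives the
    supremum over \<open>m\<close> without further loss.\<close>
  have l_minus_w: "l - w k \<in> V n" if "n + 2 \<le> k" for k n
  proof (rule order_closed_is_sup[OF closed])
    show "up_directed (range (\<lambda>m. w (k + m) - w k))"
      using w_mono by (intro up_directed_range_incseq incseq_SucI diff_right_mono) (simp add: incseq_def)
    show "is_sup (range (\<lambda>m. w (k + m) - w k)) (l - w k)"
      unfolding is_sup_def
    proof (intro conjI ballI allI impI)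
      show "d \<le> l - w k" if "d \<in> range (\<lambda>m. w (k + m) - w k)" for d
        using that w_le by (auto intro: diff_right_mono)
      fix z assume z: "\<forall>d\<in>range (\<lambda>m. w (k + m) - w k). d \<le> z"
      have "w i \<le> z + w k" for i
      proof -
        have "w i \<le> w (k + i)" using w_mono by (simp add: incseq_def)
        also have "\<dots> \<le> z + w k" using z by (auto simp: diff_le_eq)
        finally show ?thesis .
      qed
      then have "l \<le> z + w k" by (rule l_least)
      then show "l - w k \<le> z" by (simp add: diff_le_eq)
    qed
    have "w (k + m) - w k \<in> V n" for m
    proof -
      have 1: "u k - w k \<in> V (Suc (Suc n))" "u (k + m) - w (k + m) \<in> V (Suc (Suc n))"
        using antiD[OF w, of _ k] antiD[OF w, of _ "k + m"] that by auto
      have 2: "u (k + m) - u k \<in> V (Suc n)" using u_diff[of "Suc n" "k + m" k] that by simp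
      have "(u k - w k) - (u (k + m) - w (k + m)) \<in> V (Suc n)"
        using 1 by (rule VD(8))
      with 2 have "(u (k + m) - u k) + ((u k - w k) - (u (k + m) - w (k + m))) \<in> V n"
        by (rule VD(3))
      then show ?thesis by (simp add: algebra_simps)
    qed
    then show "range (\<lambda>m. w (k + m) - w k) \<subseteq> V n" by blast
  qed
  have "\<forall>\<^sub>F k in sequentially. s k - l \<in> V n" for n
  proof -
    \<comment> \<open>The sum of three differences below loses two indices and
      \<open>l_minus_w\<close> another two.\<close>
    let ?k = "n + 4"
    have "s i - l \<in> V n" if "r ?k \<le> i" for i
    proof -
      have "s i - u ?k \<in> V (Suc n)"
        unfolding u_def using that r_ge[of "Suc n" ?k] by (intro N) auto
      moreover have "(u ?k - w ?k) - (l - w ?k) \<in> V (Suc n)"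
        using antiD[OF w, of "Suc (Suc n)" ?k] l_minus_w[of "Suc (Suc n)" ?k] by (intro VD(8)[of _ "Suc n"]) auto
      ultimately have "(s i - u ?k) + ((u ?k - w ?k) - (l - w ?k)) \<in> V n"
        by (rule VD(3))
      then show ?thesis by simp
    qed
    then show ?thesis
      unfolding eventually_sequentially by blast
  qed
  moreover have "0 \<le> l" "l \<le> x"
    using order_trans[OF w_bounds(1) w_le[of 0]] l_least w_bounds(2) by auto
  ultimately show ?thesis by (intro bexI[of _ l]) auto
qed

section \<open>The carrier and submetrisability\<close>

lemma carrier_topI: "normal_seq T V \<Longrightarrow> x \<in> disj_compl (\<Inter>n. V n) \<Longrightarrow> x \<in> carrier_top T"
  unfolding carrier_top_def by blast

lemma carrier_topE:
  assumes "x \<in> carrier_top T"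
  obtains V where "normal_seq T V" "x \<in> disj_compl (\<Inter>n. V n)"
  using assms unfolding carrier_top_def by blast

text \<open>Refining the sequence shrinks the intersection and so enlarges its disjoint
  complement.\<close>

lemma carrier_topE_order_closed:
  assumes "fatou T" "x \<in> carrier_top T"
  obtains V where "normal_seq T V" "x \<in> disj_compl (\<Inter>n. V n)" "\<And>n. order_closed (V n)"
proof -
  obtain V where V: "normal_seq T V" "x \<in> disj_compl (\<Inter>n. V n)"
    using assms(2) by (rule carrier_topE)
  obtain V' where V': "normal_seq T V'" "\<And>n. V' n \<subseteq> V n" "\<And>n. order_closed (V' n)"
    by (rule normal_seq_refine_order_closed[where U = V, OF assms(1) normal_seqD(1)[OF V(1)]]) (rule that)
  have "disj_compl (\<Inter>n. V n) \<subseteq> disj_compl (\<Inter>n. V' n)"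
    using V'(2) by (intro disj_compl_antimono) blast
  with V(2) have "x \<in> disj_compl (\<Inter>n. V' n)" by blast
  with V' show thesis by (intro that)
qed

text \<open>The whole band of \<open>x\<close> is disjoint from the intersection once
  \<open>x\<close> is. This is the separation hypothesis of
  \<open>normal_seq_metrisable\<close>.\<close>

lemma INT_normal_seq_Int_pband:
  assumes "normal_seq T V" "x \<in> disj_compl (\<Inter>n. V n)"
  shows "(\<Inter>n. V n) \<inter> pband x = {0}"
proof -
  have "z = 0" if "z \<in> (\<Inter>n. V n)" "z \<in> pband x" for z
    using that pband_subset_disj_compl[OF assms(2)] disj_compl_self_Int by blast
  moreover have "0 \<in> pband x" by (rule solid_subspaceD(1)[OF solid_subspace_pband])
  ultimately show ?thesis using normal_seqD(4)[OF assms(1)] by blast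
qed

lemma metrizable_nhds0_seq:
  assumes "metrizable_space T" "0 \<in> topspace T"
  obtains U where "\<And>n::nat. nhds0 T (U n)" "(\<Inter>n. U n) = {0}"
proof -
  obtain M d where M: "Metric_space M d" "T = Metric_space.mtopology M d"
    using assms(1) unfolding metrizable_space_def by blast
  interpret Metric_space M d by (rule M)
  have 0: "0 \<in> M" using assms(2) M(2) by simp
  let ?U = "\<lambda>n::nat. mball 0 (1 / Suc n)"
  have "y = 0" if y: "y \<in> (\<Inter>n. ?U n)" for y
  proof (rule ccontr)
    assume "y \<noteq> 0"
    then have "0 < d 0 y" using y 0 by auto
    then obtain n where "inverse (real (Suc n)) < d 0 y" using reals_Archimedean by blast
    with y show False by (auto simp: inverse_eq_divide dest: spec[of _ n])
  qed
  then have "(\<Inter>n. ?U n) = {0}" using 0 by auto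
  moreover have "nhds0 T (?U n)" for n
    unfolding M(2) using 0 by (intro nhds0_open openin_mball) simp
  ultimately show thesis by (rule that[rotated])
qed

lemma locally_solidly_submetrisable_iff_carrier:
  fixes T :: "'a::{ordered_real_vector,lattice} topology"
  assumes T: "locally_solid T"
  shows "locally_solidly_submetrisable T \<longleftrightarrow> carrier_top T = UNIV"
proof
  assume L: "locally_solidly_submetrisable T"
  have "x \<in> carrier_top T" for x
  proof -
    let ?G = "pband x"
    obtain T' where T': "locally_solid_on ?G T'" "metrizable_space T'" "finer_than (subtopology T ?G) T'"
      using L unfolding locally_solidly_submetrisable_def solidly_submetrisable_def by blast
    have "0 \<in> topspace T'"
      using T'(1) solid_subspaceD(1)[OF solid_subspace_pband, of x] by (simp add: locally_solid_topspace)
    then obtain U where U: "\<And>n. nhds0 T' (U n)" "(\<Inter>n::nat. U n) = {0}"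
      using metrizable_nhds0_seq[OF T'(2)] by blast
    have "\<exists>W. nhds0 T W \<and> W \<inter> ?G \<subseteq> U n" for n
    proof -
      have "nhds0 (subtopology T ?G) (U n)"
        using U(1)[of n] T'(3) unfolding nhds0_def finer_than_def by blast
      then show ?thesis by (meson nhds0_subtopology)
    qed
    then obtain W where W: "\<And>n. nhds0 T (W n)" "\<And>n. W n \<inter> ?G \<subseteq> U n" by metis
    obtain V where V: "normal_seq T V" "\<And>n. V n \<subseteq> W n"
      using normal_seq_refine_solid[of T W] T W(1) by blast
    have "inf (vabs x) (vabs z) = 0" if z: "z \<in> (\<Inter>n. V n)" for z
    proof -
      \<comment> \<open>Solidity puts \<open>?t\<close> into every \<open>V n\<close> because of
        \<open>z\<close> and into the band because of \<open>x\<close>; there the \<open>U n\<close>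
        meet only in zero.\<close>
      let ?t = "inf (vabs x) (vabs z)"
      have "?t \<in> V n" for n
        using z normal_seqD(2)[OF V(1), of z n ?t] by auto
      moreover have "?t \<in> ?G"
        using solid_subspaceD(4)[OF solid_subspace_pband pband_self, of ?t x] by simp
      ultimately have "?t \<in> (\<Inter>n. U n)"
        using V(2) W(2) by blast
      with U(2) show ?thesis by blast
    qed
    then show ?thesis
      by (intro carrier_topI[OF V(1)]) (simp add: disj_compl_iff)
  qed
  then show "carrier_top T = UNIV" by blast
next
  assume C: "carrier_top T = UNIV"
  show "locally_solidly_submetrisable T"
    unfolding locally_solidly_submetrisable_def solidly_submetrisable_def
  proof (intro allI conjI)
    fix x :: 'a
    show "locally_solid_on (pband x) (subtopology T (pband x))"
      by (rule locally_solid_on_subtopology[OF T solid_subspace_pband])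
    obtain V where V: "normal_seq T V" "x \<in> disj_compl (\<Inter>n. V n)"
      using C carrier_topE[of x T] by blast
    show "\<exists>T'. locally_solid_on (pband x) T' \<and> metrizable_space T' \<and> finer_than (subtopology T (pband x)) T'"
      by (rule normal_seq_metrisable[OF T V(1) solid_subspace_pband INT_normal_seq_Int_pband[OF V]]) blast
  qed
qed

text \<open>Interval completeness speaks of positive vectors only; \<open>vabs x\<close> generates
  the same band as \<open>x\<close>.\<close>

lemma interval_complete_imp_submetrisable:
  assumes T: "locally_solid T" and I: "loc_interval_complete_ssm T"
  shows "locally_solidly_submetrisable T"
  unfolding locally_solidly_submetrisable_def solidly_submetrisable_def
proof (intro allI conjI)
  fix x
  show "locally_solid_on (pband x) (subtopology T (pband x))"
    by (rule locally_solid_on_subtopology[OF T solid_subspace_pband])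
  show "\<exists>T'. locally_solid_on (pband x) T' \<and> metrizable_space T' \<and> finer_than (subtopology T (pband x)) T'"
    using I[unfolded loc_interval_complete_ssm_def, rule_format, OF vabs_nonneg[of x]]
    unfolding pband_vabs by blast
qed

text \<open>An order closed normal sequence makes Nakano's argument applicable. The limit it finds
  is also the limit in the metrisable topology built from the same sequence.\<close>

lemma carrier_imp_interval_complete:
  fixes T :: "'b::{ordered_real_vector,conditionally_complete_lattice} topology"
  assumes T: "fatou T" and C: "carrier_top T = UNIV"
  shows "loc_interval_complete_ssm T"
  unfolding loc_interval_complete_ssm_def
proof (intro allI impI)
  fix x :: 'b assume "0 \<le> x"
  let ?G = "pband x"
  have ls: "locally_solid T" using T by (simp add: fatou_def)
  obtain V where V: "normal_seq T V" "x \<in> disj_compl (\<Inter>n. V n)" "\<And>n. order_closed (V n)"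
    using C carrier_topE_order_closed[OF T, of x] by blast
  obtain T' where T': "locally_solid_on ?G T'" "metrizable_space T'" "finer_than (subtopology T ?G) T'"
    "\<And>n. nhds0 T' (V n \<inter> ?G)"
    "\<And>s l. range s \<subseteq> ?G \<Longrightarrow> l \<in> ?G \<Longrightarrow> (\<And>n. \<forall>\<^sub>F k in sequentially. s k - l \<in> V n) \<Longrightarrow>
      limitin T' s l sequentially"
    using normal_seq_metrisable[OF ls V(1) solid_subspace_pband INT_normal_seq_Int_pband[OF V(1,2)]]
    by metis
  have interval: "{0..x} \<subseteq> ?G"
    using solid_subspaceD(4)[OF solid_subspace_pband pband_self, of _ x] \<open>0 \<le> x\<close> by auto
  have "\<exists>l\<in>{0..x}. limitin T' s l sequentially" if s: "\<forall>n. s n \<in> {0..x}" "tvs_cauchy T' s" for s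
  proof -
    \<comment> \<open>The trace of \<open>V n\<close> on the band is a neighbourhood of zero for
      \<open>T'\<close>, so the Cauchy condition applies to it.\<close>
    have "\<exists>N. \<forall>i\<ge>N. \<forall>j\<ge>N. s i - s j \<in> V n" for n
      using s(2) T'(4)[of n] unfolding tvs_cauchy_def by blast
    then obtain l where "l \<in> {0..x}" "\<And>n. \<forall>\<^sub>F k in sequentially. s k - l \<in> V n"
      using fatou_interval_Cauchy_converges[OF V(1,3), of s x] s(1) by auto
    with interval s(1) show ?thesis
      by (intro bexI[of _ l] T'(5)) auto
  qed
  with T' show "\<exists>T'. locally_solid_on ?G T' \<and> metrizable_space T' \<and> finer_than (subtopology T ?G) T' \<and>
    (\<forall>s. (\<forall>n. s n \<in> {0..x}) \<longrightarrow> tvs_cauchy T' s \<longrightarrow> (\<exists>l\<in>{0..x}. limitin T' s l sequentially))"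
    by blast
qed

section \<open>The carrier and the Dedekind completion\<close>

context
  fixes j :: "'a::{ordered_real_vector,lattice} \<Rightarrow> 'b::{ordered_real_vector,conditionally_complete_lattice}"
  assumes j: "dedekind_completion j"
begin

lemma dc_inj: "j x = j y \<longleftrightarrow> x = y"
  using j by (auto simp: dedekind_completion_def inj_def)

lemma dc_zero: "j 0 = 0"
  and dc_add: "j (x + y) = j x + j y"
  and dc_minus: "j (- x) = - j x"
  using j by (simp_all add: dedekind_completion_def linear_0 linear_add linear_neg)

lemma dc_sup: "j (sup x y) = sup (j x) (j y)"
  and dc_inf: "j (inf x y) = inf (j x) (j y)"
  using j by (simp_all add: dedekind_completion_def)

lemma dc_vabs: "j (vabs x) = vabs (j x)"
  by (simp add: vabs_def dc_sup dc_minus)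

lemma dc_le: "j x \<le> j y \<longleftrightarrow> x \<le> y"
  by (metis dc_inj dc_sup le_iff_sup)

text \<open>Without a majorant \<open>f\<close> would be the infimum of the empty set, hence above
  every vector, in particular above \<open>f + f\<close>. Then \<open>f\<close> is below
  \<open>0 = j 0\<close> after all.\<close>

lemma dc_majorising: "\<exists>e. f \<le> j e"
proof (rule ccontr)
  assume none: "\<nexists>e. f \<le> j e"
  then have "{j e | e. f \<le> j e} = {}" by blast
  moreover have "is_inf {j e | e. f \<le> j e} f" using j by (simp add: dedekind_completion_def)
  ultimately have "f + f \<le> f" by (simp add: is_inf_def)
  then have "f \<le> j 0" by (simp add: dc_zero)
  with none show False by blast
qed

text \<open>Since \<open>t\<close> is the supremum of the image elements below it, one of these is
  not below zero; its positive part serves.\<close>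

lemma dc_order_dense:
  assumes "0 \<le> t" "t \<noteq> 0"
  shows "\<exists>b. 0 \<le> b \<and> b \<noteq> 0 \<and> j b \<le> t"
proof -
  have "is_sup {j e | e. j e \<le> t} t" using j by (simp add: dedekind_completion_def)
  moreover have "\<not> t \<le> 0" using assms order.antisym by blast
  ultimately obtain a where a: "j a \<le> t" "\<not> j a \<le> 0" unfolding is_sup_def by blast
  have "j (sup a 0) \<le> t" using a assms by (simp add: dc_sup dc_zero)
  moreover have "sup a 0 \<noteq> 0" using a(2) dc_le[of a 0] by (metis dc_zero sup_ge1)
  ultimately show ?thesis by (intro exI[of _ "sup a 0"]) simp
qed

text \<open>Preimages of normal sequences are normal, as \<open>j\<close> is a continuous lattice
  homomorphism. In the other direction images need not be neighbourhoods, so neighbourhoods with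
  small enough preimages are chosen and refined.\<close>

lemma carrier_dedekind_completion:
  assumes \<tau>: "locally_solid \<tau>" and \<tau>d: "locally_solid \<tau>d"
    and ext: "homeomorphic_map \<tau> (subtopology \<tau>d (range j)) j"
  shows "carrier_top \<tau> = UNIV \<longleftrightarrow> carrier_top \<tau>d = UNIV"
proof
  have top: "topspace \<tau> = UNIV" using \<tau> by (rule locally_solid_topspace)
  {
    assume C: "carrier_top \<tau>d = UNIV"
    have cont: "continuous_map \<tau> \<tau>d j"
      using homeomorphic_imp_continuous_map[OF ext] by (simp add: continuous_map_in_subtopology)
    have pull: "nhds0 \<tau> (j -` U)" if U: "nhds0 \<tau>d U" for U
    proof -
      obtain W where W: "openin \<tau>d W" "0 \<in> W" "W \<subseteq> U" using U by (rule nhds0_openin)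
      have "openin \<tau> {x \<in> topspace \<tau>. j x \<in> W}"
        by (rule openin_continuous_map_preimage[OF cont W(1)])
      then have "nhds0 \<tau> (j -` W)"
        using W(2) by (intro nhds0_open) (auto simp: top dc_zero vimage_def)
      then show ?thesis by (rule nhds0_mono) (use W(3) top in auto)
    qed
    have "e \<in> carrier_top \<tau>" for e
    proof -
      obtain V where V: "normal_seq \<tau>d V" "j e \<in> disj_compl (\<Inter>n. V n)"
        using C carrier_topE[of "j e" \<tau>d] by blast
      have "normal_seq \<tau> (\<lambda>n. j -` V n)"
        unfolding normal_seq_def solid_in_def
      proof (intro allI conjI ballI impI)
        show "nhds0 \<tau> (j -` V n)" for n by (rule pull[OF normal_seqD(1)[OF V(1)]])
        show "y \<in> j -` V n" if "x \<in> j -` V n" "vabs y \<le> vabs x" for n x y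
          using that normal_seqD(2)[OF V(1), of "j x" n "j y"] by (simp add: dc_le flip: dc_vabs)
        show "{a + b |a b. a \<in> j -` V (Suc n) \<and> b \<in> j -` V (Suc n)} \<subseteq> j -` V n" for n
          using normal_seqD(3)[OF V(1)] by (auto simp: dc_add)
      qed simp
      moreover have "e \<in> disj_compl (\<Inter>n. j -` V n)"
        unfolding disj_compl_iff
      proof
        fix z assume "z \<in> (\<Inter>n. j -` V n)"
        then have "inf (vabs (j e)) (vabs (j z)) = 0" using V(2) by (auto simp: disj_compl_iff)
        then have "j (inf (vabs e) (vabs z)) = j 0" by (simp add: dc_inf dc_vabs dc_zero)
        then show "inf (vabs e) (vabs z) = 0" by (simp only: dc_inj)
      qed
      ultimately show ?thesis by (rule carrier_topI)
    qed
    then show "carrier_top \<tau> = UNIV" by blast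
  next
    assume C: "carrier_top \<tau> = UNIV"
    have push: "\<exists>W. nhds0 \<tau>d W \<and> j -` W \<subseteq> V" if V: "nhds0 \<tau> V" for V
    proof -
      obtain A where A: "openin \<tau> A" "0 \<in> A" "A \<subseteq> V" using V by (rule nhds0_openin)
      have "openin (subtopology \<tau>d (range j)) (j ` A)"
        using homeomorphic_imp_open_map[OF ext] A(1) by (simp add: open_map_def)
      then obtain W where W: "openin \<tau>d W" "j ` A = W \<inter> range j" by (auto simp: openin_subtopology)
      have "0 \<in> W" using A(2) W(2) dc_zero by (metis IntE imageI)
      moreover have "j -` W \<subseteq> A"
      proof
        fix e assume "e \<in> j -` W"
        then have "j e \<in> j ` A" using W(2) by blast
        then show "e \<in> A" by (auto simp: dc_inj)
      qed
      ultimately show ?thesis using W(1) A(3) nhds0_open by blast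
    qed
    have "f \<in> carrier_top \<tau>d" for f
    proof -
      \<comment> \<open>The normal sequence that separates this majorant of \<open>vabs f\<close>
        will also serve \<open>f\<close>.\<close>
      obtain e where e: "vabs f \<le> j e" using dc_majorising by blast
      obtain V where V: "normal_seq \<tau> V" "e \<in> disj_compl (\<Inter>n. V n)"
        using C carrier_topE[of e \<tau>] by blast
      obtain W where W: "\<And>n. nhds0 \<tau>d (W n)" "\<And>n. j -` W n \<subseteq> V n"
        using push[OF normal_seqD(1)[OF V(1)]] by metis
      obtain V' where V': "normal_seq \<tau>d V'" "\<And>n. V' n \<subseteq> W n"
        using normal_seq_refine_solid[of \<tau>d W] \<tau>d W(1) by blast
      have "inf (vabs f) (vabs u) = 0" if u: "u \<in> (\<Inter>n. V' n)" for u
      proof (rule ccontr)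
        assume "inf (vabs f) (vabs u) \<noteq> 0"
        \<comment> \<open>Order density finds a common part in the image: \<open>b\<close> lies in
          every \<open>V n\<close> and below \<open>e\<close>, yet \<open>e\<close> is disjoint from
          their intersection.\<close>
        then obtain b where b: "0 \<le> b" "b \<noteq> 0" "j b \<le> inf (vabs f) (vabs u)"
          using dc_order_dense[of "inf (vabs f) (vabs u)"] by auto
        have "0 \<le> j b" using b(1) dc_le[of 0 b] by (simp add: dc_zero)
        then have "j b \<in> V' n" for n
          using u b(3) normal_seqD(2)[OF V'(1), of u n "j b"] by auto
        then have "b \<in> (\<Inter>n. V n)" using V'(2) W(2) by blast
        with V(2) have "inf (vabs e) (vabs b) = 0" by (auto simp: disj_compl_iff)
        moreover have "b \<le> e"
          using b(3) e dc_le[of b e] by (metis le_inf_iff order_trans)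
        then have "inf (vabs e) (vabs b) = b"
          using b(1) by (simp add: inf_absorb2)
        ultimately show False using b(2) by simp
      qed
      then show ?thesis
        by (intro carrier_topI[OF V'(1)]) (simp add: disj_compl_iff)
    qed
    then show "carrier_top \<tau>d = UNIV" by blast
  }
qed

end

section \<open>The carrier and the countable sup property\<close>

text \<open>As \<open>N\<close> is a band, \<open>w\<close> is not the supremum of the part of
  \<open>N\<close> below it. An upper bound \<open>z\<close> of that part leaves the gap
  \<open>v = w - inf z w\<close>. If \<open>t \<le> v\<close> lies in \<open>N\<close>, its
  multiples below \<open>w\<close> are below \<open>z\<close>, hence below \<open>w - v\<close>, and
  \<open>archimedean_step\<close> gives \<open>t = 0\<close>.\<close>

lemma disjoint_below_outside_band:
  fixes w :: "'a::{ordered_real_vector,lattice}"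
  assumes arch: "archimedean_vl TYPE('a)" and N: "solid_subspace N" "order_closed N"
    and w: "0 \<le> w" "w \<notin> N"
  obtains v where "v \<in> disj_compl N" "0 \<le> v" "v \<le> w" "v \<noteq> 0"
proof -
  note ND = solid_subspaceD[OF N(1)]
  let ?A = "{u \<in> N. 0 \<le> u \<and> u \<le> w}"
  have "up_directed ?A"
    unfolding up_directed_def
  proof (intro conjI ballI)
    show "?A \<noteq> {}" using ND(1) w(1) by blast
    fix a b assume ab: "a \<in> ?A" "b \<in> ?A"
    then have "0 \<le> sup a b" "sup a b \<le> a + b" by (auto intro: le_supI1 simp: add_increasing add_increasing2)
    then have "sup a b \<in> N" using ND(4)[OF ND(2)[of a b], of "sup a b"] ab by auto
    with ab \<open>0 \<le> sup a b\<close> show "\<exists>c\<in>?A. a \<le> c \<and> b \<le> c" by (intro bexI[of _ "sup a b"]) auto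
  qed
  then have "\<not> is_sup ?A w" using order_closed_is_sup[OF N(2)] w(2) by blast
  then obtain z where z: "\<And>u. u \<in> N \<Longrightarrow> 0 \<le> u \<Longrightarrow> u \<le> w \<Longrightarrow> u \<le> z" "\<not> w \<le> z"
    unfolding is_sup_def by blast
  define v where "v = w - inf z w"
  have "0 \<le> inf z w" using z(1)[OF ND(1)] w(1) by simp
  then have v: "0 \<le> v" "v \<le> w" by (simp_all add: v_def)
  have "v \<noteq> 0" using z(2) by (auto simp: v_def le_iff_inf inf_commute)
  have "v \<in> disj_compl N"
    unfolding disj_compl_iff
  proof
    fix y assume "y \<in> N"
    let ?t = "inf v (vabs y)"
    have t: "0 \<le> ?t" "?t \<le> v" using v(1) by auto
    have "?t \<in> N" using ND(4)[OF \<open>y \<in> N\<close>, of ?t] t(1) by simp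
    have "?t = 0"
    proof (rule archimedean_step[OF arch t(1)])
      show "?t \<le> w" using t(2) v(2) by (rule order_trans)
      fix n assume n: "real n *\<^sub>R ?t \<le> w"
      have "real n *\<^sub>R ?t \<le> z"
        using z(1)[OF ND(3)[OF \<open>?t \<in> N\<close>] _ n] t(1) by (simp add: scaleR_nonneg_nonneg)
      with n have "real n *\<^sub>R ?t \<le> w - v" by (simp add: v_def)
      also have "\<dots> \<le> w - ?t" using t(2) by (rule diff_left_mono)
      finally show "real n *\<^sub>R ?t \<le> w - ?t" .
    qed
    with v(1) show "inf (vabs v) (vabs y) = 0" by simp
  qed
  with v \<open>v \<noteq> 0\<close> show thesis by (intro that)
qed

lemma vabs_in_carrier_top: "vabs x \<in> carrier_top T \<longleftrightarrow> x \<in> carrier_top T"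
proof -
  have "vabs x \<in> disj_compl N \<longleftrightarrow> x \<in> disj_compl N" for N
    by (simp add: disj_compl_iff)
  then show ?thesis unfolding carrier_top_def by blast
qed

text \<open>A neighbourhood missing \<open>w\<close> exists by the Hausdorff property. Refined to an
  order closed normal sequence, its intersection is a band that does not contain
  \<open>w\<close>.\<close>

lemma nonneg_below_carrier_top:
  fixes T :: "'a::{ordered_real_vector,lattice} topology"
  assumes arch: "archimedean_vl TYPE('a)" and T: "fatou T" and w: "0 \<le> w" "w \<noteq> 0"
  obtains V v where "normal_seq T V" "v \<in> disj_compl (\<Inter>n. V n)" "0 \<le> v" "v \<le> w" "v \<noteq> 0"
proof -
  have ls: "locally_solid T" using T by (simp add: fatou_def)
  then have "Hausdorff_space T" "topspace T = UNIV"
    by (auto simp: locally_solid_on_def linear_topology_on_def)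
  then obtain U where U: "openin T U" "0 \<in> U" "w \<notin> U"
    using w(2) unfolding Hausdorff_space_def disjnt_iff by (metis UNIV_I)
  obtain V where V: "normal_seq T V" "\<And>n. V n \<subseteq> U" "\<And>n. order_closed (V n)"
    using normal_seq_refine_order_closed[OF T, of "\<lambda>_. U"] nhds0_open[OF U(1,2)] by blast
  obtain v where "v \<in> disj_compl (\<Inter>n. V n)" "0 \<le> v" "v \<le> w" "v \<noteq> 0"
  proof (rule disjoint_below_outside_band[OF arch _ _ w(1)])
    show "solid_subspace (\<Inter>n. V n)" by (rule solid_subspace_INT_normal_seq[OF ls V(1)])
    show "order_closed (\<Inter>n. V n)" by (intro order_closed_INT V)
    show "w \<notin> (\<Inter>n. V n)" using U(3) V(2) by blast
  qed
  with V(1) show thesis by (rule that)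
qed

text \<open>A gap between \<open>x\<close> and another upper bound \<open>z\<close> would contain a
  nonzero carrier element \<open>v\<close>. Its multiples stay in the carrier, so those below
  \<open>x\<close> are below \<open>z\<close>, and exhaustion gives \<open>v = 0\<close>.\<close>

lemma is_sup_carrier_top_interval:
  fixes T :: "'a::{ordered_real_vector,lattice} topology"
  assumes arch: "archimedean_vl TYPE('a)" and T: "fatou T" and x: "0 \<le> x"
  shows "is_sup (carrier_top T \<inter> {0..x}) x"
  unfolding is_sup_def
proof (intro conjI allI impI)
  fix z assume z: "\<forall>y\<in>carrier_top T \<inter> {0..x}. y \<le> z"
  define w where "w = x - inf z x"
  have "w = 0"
  proof (rule ccontr)
    assume "w \<noteq> 0"
    moreover have "0 \<le> w" by (simp add: w_def)
    ultimately obtain V v where V: "normal_seq T V" and v: "v \<in> disj_compl (\<Inter>n. V n)" "0 \<le> v" "v \<le> w" "v \<noteq> 0"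
      using nonneg_below_carrier_top[OF arch T] by metis
    have mult: "real n *\<^sub>R v \<in> carrier_top T" for n
      using solid_subspaceD(3)[OF solid_subspace_disj_compl v(1)] by (rule carrier_topI[OF V])
    \<comment> \<open>Zero is itself a carrier element of the interval, being the multiple with
      \<open>n = 0\<close>.\<close>
    have "0 \<le> z" using z x mult[of 0] by simp
    then have "w \<le> x" using x by (simp add: w_def)
    have "v = 0"
    proof (rule archimedean_step[OF arch v(2)])
      show "v \<le> x" using v(3) \<open>w \<le> x\<close> by (rule order_trans)
      fix n assume n: "real n *\<^sub>R v \<le> x"
      then have "real n *\<^sub>R v \<le> z"
        using z mult[of n] v(2) by (simp add: scaleR_nonneg_nonneg)
      with n have "real n *\<^sub>R v \<le> x - w" by (simp add: w_def)
      also have "\<dots> \<le> x - v" using v(3) by (rule diff_left_mono)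
      finally show "real n *\<^sub>R v \<le> x - v" .
    qed
    with v(4) show False by simp
  qed
  then show "x \<le> z" by (simp add: w_def le_iff_inf inf_commute)
qed simp

text \<open>The \<open>n\<close>-th set is taken inside \<open>V k n\<close> for all
  \<open>k \<le> n\<close>, a finite intersection. For \<open>k > n\<close> the set with index
  \<open>k\<close> lies inside \<open>V k n\<close>.\<close>

lemma normal_seq_diagonal:
  assumes T: "locally_solid T" and V: "\<And>k::nat. normal_seq T (V k)"
  obtains V' where "normal_seq T V'" "\<And>k. (\<Inter>n. V' n) \<subseteq> (\<Inter>n. V k n)"
proof -
  have "nhds0 T (\<Inter>k\<le>n. V k n)" for n
    using normal_seqD(1)[OF V] by (intro nhds0_INT) auto
  then obtain V' where V': "normal_seq T V'" "\<And>n. V' n \<subseteq> (\<Inter>k\<le>n. V k n)"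
    using normal_seq_refine_solid[OF T, of "\<lambda>n. \<Inter>k\<le>n. V k n"] by blast
  have "(\<Inter>n. V' n) \<subseteq> V k n" for k n
    using V'(2)[of "max k n"] normal_seqD(6)[OF V, of n "max k n" k] by fastforce
  then show thesis by (intro that[OF V'(1)]) blast
qed

text \<open>Countably many carrier elements with supremum \<open>x\<close> share one diagonal normal
  sequence, and its disjoint complement is closed under this supremum.\<close>

lemma countable_sup_imp_carrier:
  fixes T :: "'a::{ordered_real_vector,lattice} topology"
  assumes arch: "archimedean_vl TYPE('a)" and T: "fatou T"
    and C: "countable_sup_property TYPE('a)"
  shows "carrier_top T = UNIV"
proof -
  have ls: "locally_solid T" using T by (simp add: fatou_def)
  have "x \<in> carrier_top T" if x: "0 \<le> x" for x
  proof -
    let ?D = "carrier_top T \<inter> {0..x}"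
    obtain S where S: "S \<subseteq> ?D" "countable S" "is_sup S x"
      using C is_sup_carrier_top_interval[OF arch T x] unfolding countable_sup_property_def by blast
    show ?thesis
    proof (cases "S = {}")
      \<comment> \<open>The countable subset may be empty; its supremum \<open>x\<close> is then a
        least element, hence zero.\<close>
      case True
      with S(3) have "x \<le> y" for y by (simp add: is_sup_def)
      with x have "x = 0" by (simp add: order.antisym)
      obtain V where "normal_seq T V"
        using normal_seq_refine_solid[OF ls, of "\<lambda>_. UNIV"] ls nhds0_open[of T UNIV]
        by (metis UNIV_I locally_solid_topspace openin_topspace)
      with \<open>x = 0\<close> show ?thesis
        using solid_subspaceD(1)[OF solid_subspace_disj_compl] by (blast intro: carrier_topI)
    next
      case False
      define y where "y = from_nat_into S"
      have y: "range y = S"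
        unfolding y_def by (rule range_from_nat_into[OF False S(2)])
      have "\<exists>V. normal_seq T V \<and> y k \<in> disj_compl (\<Inter>n. V n)" for k
        using S(1) y carrier_topE[of "y k" T] by blast
      then obtain V where V: "\<And>k. normal_seq T (V k)" "\<And>k. y k \<in> disj_compl (\<Inter>n. V k n)" by metis
      obtain V' where V': "normal_seq T V'" "\<And>k. (\<Inter>n. V' n) \<subseteq> (\<Inter>n. V k n)"
        by (rule normal_seq_diagonal[where V = V, OF ls V(1)]) (rule that)
      have "S \<subseteq> disj_compl (\<Inter>n. V' n)"
        using V(2) disj_compl_antimono[OF V'(2)] y by blast
      then have "x \<in> disj_compl (\<Inter>n. V' n)"
        by (rule disj_compl_is_sup[OF _ S(3) _ x]) (use S(1) in auto)
      with V'(1) show ?thesis by (rule carrier_topI)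
    qed
  qed
  then show ?thesis
    using vabs_in_carrier_top vabs_nonneg by blast
qed

section \<open>Finite suprema and the choice of countable subsets\<close>

lemma up_directed_finite_sups:
  fixes S :: "'a::lattice set"
  assumes "S \<noteq> {}"
  shows "up_directed {Sup_fin F | F. finite F \<and> F \<noteq> {} \<and> F \<subseteq> S}"
  unfolding up_directed_def
proof (intro conjI ballI)
  show "{Sup_fin F | F. finite F \<and> F \<noteq> {} \<and> F \<subseteq> S} \<noteq> {}"
    using assms by blast
  fix a b assume "a \<in> {Sup_fin F | F. finite F \<and> F \<noteq> {} \<and> F \<subseteq> S}" "b \<in> {Sup_fin F | F. finite F \<and> F \<noteq> {} \<and> F \<subseteq> S}"
  then obtain F G where F: "a = Sup_fin F" "finite F" "F \<noteq> {}" "F \<subseteq> S"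
    and G: "b = Sup_fin G" "finite G" "G \<noteq> {}" "G \<subseteq> S"
    by blast
  have "Sup_fin (F \<union> G) = sup a b"
    unfolding F(1) G(1) by (rule Sup_fin.union) (fact F G)+
  with F G show "\<exists>c\<in>{Sup_fin F | F. finite F \<and> F \<noteq> {} \<and> F \<subseteq> S}. a \<le> c \<and> b \<le> c"
    by (intro bexI[of _ "Sup_fin (F \<union> G)"]) (auto intro!: exI[of _ "F \<union> G"])
qed

lemma is_sup_finite_sups:
  fixes S :: "'a::lattice set"
  assumes "is_sup S s"
  shows "is_sup {Sup_fin F | F. finite F \<and> F \<noteq> {} \<and> F \<subseteq> S} s"
  unfolding is_sup_def
proof (intro conjI ballI allI impI)
  show "y \<le> s" if y: "y \<in> {Sup_fin F | F. finite F \<and> F \<noteq> {} \<and> F \<subseteq> S}" for y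
  proof -
    obtain F where F: "y = Sup_fin F" "finite F" "F \<noteq> {}" "F \<subseteq> S" using y by blast
    then show ?thesis
      using assms Sup_fin.bounded_iff[OF F(2,3), of s] by (auto simp: is_sup_def)
  qed
  fix z assume z: "\<forall>y\<in>{Sup_fin F | F. finite F \<and> F \<noteq> {} \<and> F \<subseteq> S}. y \<le> z"
  have "x \<le> z" if "x \<in> S" for x
  proof -
    have "x = Sup_fin {x}" by simp
    with that have "x \<in> {Sup_fin F | F. finite F \<and> F \<noteq> {} \<and> F \<subseteq> S}" by blast
    with z show ?thesis by blast
  qed
  then show "s \<le> z" using assms by (simp add: is_sup_def)
qed

lemma carrier_imp_countable_sup:
  fixes T :: "'a::{ordered_real_vector,lattice} topology"
  assumes T: "o_lebesgue T" and C: "carrier_top T = UNIV"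
  shows "countable_sup_property TYPE('a)"
  unfolding countable_sup_property_def
proof (intro allI impI)
  fix S :: "'a set" and s assume s: "is_sup S s"
  have ls: "locally_solid T" using T by (simp add: o_lebesgue_def)
  then have lin: "linear_topology_on UNIV T" by (simp add: locally_solid_on_def)
  show "\<exists>S'\<subseteq>S. countable S' \<and> is_sup S' s"
  proof (cases "S = {}")
    case True
    with s show ?thesis by auto
  next
    case False
    then obtain a where a: "a \<in> S" by blast
    let ?F = "{Sup_fin F | F. finite F \<and> F \<noteq> {} \<and> F \<subseteq> S}"
    note dir = up_directed_finite_sups[OF False] and sup = is_sup_finite_sups[OF s]
    have lim: "limitin T id s (tail_filter ?F)"
      using T tail_filter_nontrivial[OF dir] tail_filter_order_conv[OF dir sup]
      unfolding o_lebesgue_def by blast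
    obtain V where V: "normal_seq T V" "s - a \<in> disj_compl (\<Inter>n. V n)"
      using C carrier_topE[of "s - a" T] by blast
    \<comment> \<open>The finite suprema are kept above \<open>a\<close>, so that all gaps to
      \<open>s\<close> stay below \<open>s - a\<close>.\<close>
    have "a \<in> ?F" using a by (auto intro!: exI[of _ "{a}"])
    have "\<exists>F. finite F \<and> F \<noteq> {} \<and> F \<subseteq> S \<and> a \<le> Sup_fin F \<and> Sup_fin F - s \<in> V n" for n
    proof -
      obtain U where U: "openin T U" "s \<in> U" "\<And>y. y \<in> U \<Longrightarrow> y - s \<in> V n"
        using open_translate_nhds0[OF lin normal_seqD(1)[OF V(1)]] by blast
      have "eventually (\<lambda>y. y \<in> U) (tail_filter ?F)"
        using lim U(1,2) unfolding limitin_def by simp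
      then obtain y where y: "y \<in> ?F" "\<And>z. z \<in> ?F \<Longrightarrow> y \<le> z \<Longrightarrow> z \<in> U"
        unfolding eventually_tail_filter[OF dir] by blast
      obtain c where "c \<in> ?F" "y \<le> c" "a \<le> c"
        using dir y(1) \<open>a \<in> ?F\<close> unfolding up_directed_def by meson
      with y(2) U(3) show ?thesis by blast
    qed
    then obtain F where F: "\<And>n. finite (F n)" "\<And>n. F n \<noteq> {}" "\<And>n. F n \<subseteq> S"
      "\<And>n. a \<le> Sup_fin (F n)" "\<And>n. Sup_fin (F n) - s \<in> V n" by metis
    have "is_sup (\<Union>n. F n) s"
      unfolding is_sup_def
    proof (intro conjI ballI allI impI)
      show "y \<le> s" if "y \<in> (\<Union>n. F n)" for y
        using that F(3) s unfolding is_sup_def by blast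
      fix z assume z: "\<forall>y\<in>(\<Union>n. F n). y \<le> z"
      \<comment> \<open>The shortfall of \<open>z\<close> is dominated by every
        \<open>s - Sup_fin (F n)\<close>, so it lies in all \<open>V n\<close>, and by
        \<open>s - a\<close>, so it is disjoint from their intersection. Hence it vanishes.\<close>
      define w where "w = s - inf z s"
      have "0 \<le> w" by (simp add: w_def)
      have w_le: "w \<le> s - Sup_fin (F n)" for n
      proof -
        have "Sup_fin (F n) \<le> z" using z F(1,2)[of n] by (auto simp: Sup_fin.bounded_iff)
        moreover have "Sup_fin (F n) \<le> s" using sup F(1-3)[of n] unfolding is_sup_def by blast
        ultimately show ?thesis by (simp add: w_def diff_left_mono)
      qed
      have "w \<in> V n" for n
      proof (rule normal_seqD(2)[OF V(1) F(5)])
        have "0 \<le> s - Sup_fin (F n)" using \<open>0 \<le> w\<close> w_le by (rule order_trans)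
        then show "vabs w \<le> vabs (Sup_fin (F n) - s)"
          using w_le[of n] \<open>0 \<le> w\<close> by (simp add: vabs_minus_commute[of _ s])
      qed
      moreover have "w \<in> disj_compl (\<Inter>n. V n)"
      proof (rule solid_subspaceD(4)[OF solid_subspace_disj_compl V(2)])
        have "w \<le> s - a" using w_le[of 0] F(4)[of 0] by (meson diff_left_mono order_trans)
        also have "\<dots> \<le> vabs (s - a)" by (rule vabs_upper)
        finally show "vabs w \<le> vabs (s - a)" using \<open>0 \<le> w\<close> by simp
      qed
      ultimately have "w = 0" using disj_compl_self_Int[of w "\<Inter>n. V n"] by blast
      then show "s \<le> z" by (simp add: w_def le_iff_inf inf_commute)
    qed
    moreover have "countable (\<Union>n. F n)" using F(1) by (intro countable_UN) (auto intro: countable_finite)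
    ultimately show ?thesis using F(3) by (intro exI[of _ "\<Union>n. F n"]) blast
  qed
qed

theorem theorem3p11:
  fixes \<tau> :: "'a::{ordered_real_vector,lattice} topology"
    and \<tau>d :: "'b::{ordered_real_vector,conditionally_complete_lattice} topology"
    and j :: "'a \<Rightarrow> 'b"
  assumes arch: "archimedean_vl TYPE('a)"
    and fat: "fatou \<tau>"
    and compl: "dedekind_completion j"
    and fatd: "fatou \<tau>d"
    and ext: "homeomorphic_map \<tau> (subtopology \<tau>d (range j)) j"
  shows "(locally_solidly_submetrisable \<tau> \<longleftrightarrow> locally_solidly_submetrisable \<tau>d)
       \<and> (locally_solidly_submetrisable \<tau>d \<longleftrightarrow> loc_interval_complete_ssm \<tau>d)
       \<and> (loc_interval_complete_ssm \<tau>d \<longleftrightarrow> carrier_top \<tau> = UNIV)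
       \<and> (carrier_top \<tau> = UNIV \<longleftrightarrow> carrier_top \<tau>d = UNIV)
       \<and> (o_lebesgue \<tau> \<longrightarrow>
            (locally_solidly_submetrisable \<tau> \<longleftrightarrow> countable_sup_property TYPE('a)))"
proof -
  have ls: "locally_solid \<tau>" "locally_solid \<tau>d"
    using fat fatd by (simp_all add: fatou_def)
  have "locally_solidly_submetrisable \<tau> \<longleftrightarrow> carrier_top \<tau> = UNIV"
    "locally_solidly_submetrisable \<tau>d \<longleftrightarrow> carrier_top \<tau>d = UNIV"
    by (intro locally_solidly_submetrisable_iff_carrier ls)+
  moreover have "carrier_top \<tau> = UNIV \<longleftrightarrow> carrier_top \<tau>d = UNIV"
    by (rule carrier_dedekind_completion[OF compl ls ext])
  \<comment> \<open>A full carrier gives interval completeness, which contains local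
    submetrisability, which returns the full carrier.\<close>
  moreover have "loc_interval_complete_ssm \<tau>d \<longleftrightarrow> carrier_top \<tau>d = UNIV"
    using carrier_imp_interval_complete[OF fatd] interval_complete_imp_submetrisable[OF ls(2)]
      locally_solidly_submetrisable_iff_carrier[OF ls(2)] by blast
  moreover have "o_lebesgue \<tau> \<Longrightarrow> carrier_top \<tau> = UNIV \<longleftrightarrow> countable_sup_property TYPE('a)"
    using carrier_imp_countable_sup countable_sup_imp_carrier[OF arch fat] by blast
  ultimately show ?thesis by blast
qed

end
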